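(* Let $f:\mathcal M^2\to\{0,1\}$ be a function defined in the ground model $\mathcal M$ such that the binary relation $f(x,y)=1$ is well founded in $\mathcal M$. Then for every formula $F[x]$ of ZF$_\varepsilon$ with parameters in $\mathcal M$: $$Y\Vdash\forall y\big(\forall x(f(x,y)=1\hookrightarrow F[x])\to F[y]\big)\to\forall y\,F[y],$$ where $Y=AA$ and $A=\lambda a\lambda f(f)(a)af$ (equivalently $A=(W)(B)(BW)(C)B$).
   Context: A realizability algebra consists of sets $\Lambda$ (terms), $\Pi$ (stacks), $\Lambda\star\Pi$ (processes), maps $(\xi,\eta)\mapsto(\xi)\eta$ (application, $\Lambda^2\to\Lambda$; $(\xi)\eta_1\dots\eta_n$ means left-nested application), $(\xi,\pi)\mapsto\xi\cdot\pi$ ($\Lambda\times\Pi\to\Pi$), $(\xi,\pi)\mapsto\xi\star\pi$ ($\Lambda\times\Pi\to\Lambda\star\Pi$), $\pi\mapsto k_\pi$ ($\Pi\to\Lambda$), and distinguished terms $B,C,I,K,W,\mathrm{cc}$. Execution $\succ$ is the least reflexive transitive relation on $\Lambda\star\Pi$ with $(\xi)\eta\star\pi\succ\xi\star\eta\cdot\pi$, $I\star\xi\cdot\pi\succ\xi\star\pi$, $K\star\xi\cdot\eta\cdot\pi\succ\xi\star\pi$, $W\star\xi\cdot\eta\cdot\pi\succ\xi\star\eta\cdot\eta\cdot\pi$, $C\star\xi\cdot\eta\cdot\zeta\cdot\pi\succ\xi\star\zeta\cdot\eta\cdot\pi$, $B\star\xi\cdot\eta\cdot\zeta\cdot\pi\succ\xi\star(\eta)\zeta\cdot\pi$,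 $\mathrm{cc}\star\xi\cdot\pi\succ\xi\star k_\pi\cdot\pi$, $k_\pi\star\xi\cdot\varpi\succ\xi\star\pi$. A set $\perp\!\!\!\perp\subseteq\Lambda\star\Pi$ is given, closed under anti-execution ($\xi\star\pi\succ\xi'\star\pi'\in\perp\!\!\!\perp\Rightarrow\xi\star\pi\in\perp\!\!\!\perp$), and a set QP of proof-like terms containing the six instructions and closed under application; the algebra is coherent if for each $\theta\in$ QP some $\pi$ has $\theta\star\pi\notin\perp\!\!\!\perp$. $\lambda$-terms are translated into combinatory terms (built from instructions by application) by a fixed bracket abstraction such that $\lambda x_1\dots\lambda x_n t\star\xi_1\cdot\ldots\cdot\xi_n\cdot\pi\succ t[\vec\xi/\vec x]\star\pi$. The ground model $\mathcal M$ satisfies ZF + $V=L$ and a coherent realizability algebra $\mathcal A$ is given in $\mathcal M$. Formulas of ZF$_\varepsilon$ are built from atomic $\top,\bot,t\not\varepsilon u,t\notin u,t\subset u$ with only $\to,\forall$; $\neg A$ is $A\to\bot$. Every functional definable in $\mathcal M$ is a function symbol with its $\mathcal M$-interpretation. The realizability model $\mathcal N_{\mathcal A}$ has the individuals of $\mathcal M$; closed formulas with parameters get falsity values $\|F\|\subseteq\Pi$: $\|\top\|=\emptyset$, $\|\bot\|=\Pi$, $\|a\not\varepsilon b\|=\{\pi:(a,\pi)\in b\}$, $\|a\subset b\|=\bigcup_c\{\xi\cdot\pi:(c,\pi)\in a,\xi\Vdash c\notin b\}$, $\|a\notin b\|=\bigcup_c\{\xi\cdot\xi'\cdot\pi:(c,\pi)\in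 b,\xi\Vdash a\subset c,\xi'\Vdash c\subset a\}$ (induction on ranks), $\|A\to B\|=\{\xi\cdot\pi:\xi\Vdash A,\pi\in\|B\|\}$, $\|\forall xA\|=\bigcup_a\|A[a/x]\|$; $\xi\Vdash F$ means $\xi\star\pi\in\perp\!\!\!\perp$ for all $\pi\in\|F\|$. For terms $t,u$ (built from variables, parameters and function symbols of $\mathcal M$): $\|t=u\hookrightarrow F\|=\|F\|$ if $t=u$ holds in $\mathcal M$, and $=\emptyset$ otherwise. *)

theory Defs
  imports Main
begin

text \<open>
  A structure for the language of set theory is a type \<open>'m\<close> with an arbitrary binary relation
  \<open>E\<close> (\<open>E x y\<close> means that \<open>x\<close> is a member of \<open>y\<close> in the structure).  Nothing is assumed about
  well-foundedness of \<open>E\<close> outside the structure or about its integers being standard.  Therefore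
  every notion that depends on integers, recursion or least fixed points is interpreted inside the
  structure, with all quantifiers ranging over \<open>'m\<close>.
\<close>

section \<open>Models of ZF\<close>

datatype fm = Mem nat nat | Equ nat nat | Neg fm | Con fm fm | Forall fm
  \<comment> \<open>de Bruijn indices\<close>

primrec sat :: "('m \<Rightarrow> 'm \<Rightarrow> bool) \<Rightarrow> (nat \<Rightarrow> 'm) \<Rightarrow> fm \<Rightarrow> bool" where
  "sat E e (Mem i j) \<longleftrightarrow> E (e i) (e j)"
| "sat E e (Equ i j) \<longleftrightarrow> e i = e j"
| "sat E e (Neg p) \<longleftrightarrow> \<not> sat E e p"
| "sat E e (Con p q) \<longleftrightarrow> sat E e p \<and> sat E e q"
| "sat E e (Forall p) \<longleftrightarrow> (\<forall>a. sat E (case_nat a e) p)"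

definition ext :: "('m \<Rightarrow> 'm \<Rightarrow> bool) \<Rightarrow> 'm \<Rightarrow> 'm set" where
  "ext E a = {x. E x a}"

text \<open>The parameters of the instances of separation and replacement are supplied by \<open>e\<close>.\<close>

definition ZF :: "('m \<Rightarrow> 'm \<Rightarrow> bool) \<Rightarrow> bool" where
  "ZF E \<longleftrightarrow>
     (\<forall>a b. (\<forall>x. E x a \<longleftrightarrow> E x b) \<longrightarrow> a = b) \<and>
     (\<forall>a. (\<exists>x. E x a) \<longrightarrow> (\<exists>x. E x a \<and> \<not> (\<exists>y. E y x \<and> E y a))) \<and>
     (\<forall>a b. \<exists>c. \<forall>x. E x c \<longleftrightarrow> x = a \<or> x = b) \<and>
     (\<forall>a. \<exists>u. \<forall>x. E x u \<longleftrightarrow> (\<exists>y. E x y \<and> E y a)) \<and>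
     (\<forall>a. \<exists>p. \<forall>x. E x p \<longleftrightarrow> (\<forall>y. E y x \<longrightarrow> E y a)) \<and>
     (\<exists>w. (\<exists>z. (\<forall>x. \<not> E x z) \<and> E z w) \<and>
          (\<forall>x. E x w \<longrightarrow> (\<exists>y. (\<forall>z. E z y \<longleftrightarrow> E z x \<or> z = x) \<and> E y w))) \<and>
     (\<forall>p e a. \<exists>b. \<forall>x. E x b \<longleftrightarrow> E x a \<and> sat E (case_nat x e) p) \<and>
     (\<forall>p e a. (\<forall>x. E x a \<longrightarrow> (\<exists>!y. sat E (case_nat x (case_nat y e)) p)) \<longrightarrow>
        (\<exists>b. \<forall>y. E y b \<longleftrightarrow> (\<exists>x. E x a \<and> sat E (case_nat x (case_nat y e)) p)))"

section \<open>Basic set-theoretic notions inside a model\<close>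

definition emptyset :: "('m \<Rightarrow> 'm \<Rightarrow> bool) \<Rightarrow> 'm" where
  "emptyset E = (THE z. \<forall>x. \<not> E x z)"

definition upair :: "('m \<Rightarrow> 'm \<Rightarrow> bool) \<Rightarrow> 'm \<Rightarrow> 'm \<Rightarrow> 'm" where
  "upair E a b = (THE c. \<forall>x. E x c \<longleftrightarrow> x = a \<or> x = b)"

definition pair :: "('m \<Rightarrow> 'm \<Rightarrow> bool) \<Rightarrow> 'm \<Rightarrow> 'm \<Rightarrow> 'm" where
  "pair E a b = upair E (upair E a a) (upair E a b)"

definition succ :: "('m \<Rightarrow> 'm \<Rightarrow> bool) \<Rightarrow> 'm \<Rightarrow> 'm" where
  "succ E a = (THE b. \<forall>x. E x b \<longleftrightarrow> E x a \<or> x = a)"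

definition one :: "('m \<Rightarrow> 'm \<Rightarrow> bool) \<Rightarrow> 'm" where
  "one E = succ E (emptyset E)"

definition omega :: "('m \<Rightarrow> 'm \<Rightarrow> bool) \<Rightarrow> 'm" where
  "omega E = (THE w. \<forall>x. E x w \<longleftrightarrow>
     (\<forall>u. E (emptyset E) u \<and> (\<forall>y. E y u \<longrightarrow> E (succ E y) u) \<longrightarrow> E x u))"

definition transitive :: "('m \<Rightarrow> 'm \<Rightarrow> bool) \<Rightarrow> 'm \<Rightarrow> bool" where
  "transitive E a \<longleftrightarrow> (\<forall>x y. E x y \<and> E y a \<longrightarrow> E x a)"

definition ordinal :: "('m \<Rightarrow> 'm \<Rightarrow> bool) \<Rightarrow> 'm \<Rightarrow> bool" where
  "ordinal E a \<longleftrightarrow> transitive E a \<and> (\<forall>x. E x a \<longrightarrow> transitive E x)"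

definition cart :: "('m \<Rightarrow> 'm \<Rightarrow> bool) \<Rightarrow> 'm \<Rightarrow> 'm \<Rightarrow> 'm set" where
  "cart E a b = {pair E x y | x y. E x a \<and> E y b}"

text \<open>\<open>is_fun E f D R\<close>: the element \<open>f\<close> of the model is the graph of a function from \<open>D\<close> to \<open>R\<close>.\<close>

definition is_fun :: "('m \<Rightarrow> 'm \<Rightarrow> bool) \<Rightarrow> 'm \<Rightarrow> 'm set \<Rightarrow> 'm set \<Rightarrow> bool" where
  "is_fun E f D R \<longleftrightarrow>
     (\<forall>p. E p f \<longrightarrow> (\<exists>x\<in>D. \<exists>y\<in>R. p = pair E x y)) \<and>
     (\<forall>x\<in>D. \<exists>!y. E (pair E x y) f)"

definition fapp :: "('m \<Rightarrow> 'm \<Rightarrow> bool) \<Rightarrow> 'm \<Rightarrow> 'm \<Rightarrow> 'm" where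
  "fapp E f x = (THE y. E (pair E x y) f)"

section \<open>The axiom of constructibility\<close>

text \<open>
  Since formulas have to be taken inside the model, definability over a set \<open>a\<close> is expressed
  without coding of syntax: the relations on \<open>a\<close> defined by first-order formulas are the members
  of the least family (in the model) of sets of assignments \<open>\<omega> \<rightarrow> a\<close> that contains the atomic
  relations and is closed under complement, intersection and projection.
\<close>

definition asg :: "('m \<Rightarrow> 'm \<Rightarrow> bool) \<Rightarrow> 'm \<Rightarrow> 'm \<Rightarrow> bool" where
  "asg E a s \<longleftrightarrow> is_fun E s (ext E (omega E)) (ext E a)"

definition upd :: "('m \<Rightarrow> 'm \<Rightarrow> bool) \<Rightarrow> 'm \<Rightarrow> 'm \<Rightarrow> 'm \<Rightarrow> 'm" where
  "upd E s i x = (THE t. \<forall>p. E p t \<longleftrightarrow> (E p s \<and> \<not> (\<exists>y. p = pair E i y)) \<or> p = pair E i x)"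

definition def_family :: "('m \<Rightarrow> 'm \<Rightarrow> bool) \<Rightarrow> 'm \<Rightarrow> 'm \<Rightarrow> bool" where
  "def_family E a D \<longleftrightarrow>
     (\<forall>i j r. E i (omega E) \<and> E j (omega E) \<and>
        (\<forall>s. E s r \<longleftrightarrow> asg E a s \<and> E (fapp E s i) (fapp E s j)) \<longrightarrow> E r D) \<and>
     (\<forall>i j r. E i (omega E) \<and> E j (omega E) \<and>
        (\<forall>s. E s r \<longleftrightarrow> asg E a s \<and> fapp E s i = fapp E s j) \<longrightarrow> E r D) \<and>
     (\<forall>q r. E q D \<and> (\<forall>s. E s r \<longleftrightarrow> asg E a s \<and> \<not> E s q) \<longrightarrow> E r D) \<and>
     (\<forall>p q r. E p D \<and> E q D \<and> (\<forall>s. E s r \<longleftrightarrow> E s p \<and> E s q) \<longrightarrow> E r D) \<and>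
     (\<forall>i q r. E i (omega E) \<and> E q D \<and>
        (\<forall>s. E s r \<longleftrightarrow> asg E a s \<and> (\<exists>x. E x a \<and> E (upd E s i x) q)) \<longrightarrow> E r D)"

text \<open>
  \<open>defpow E a x\<close>: \<open>x\<close> is a subset of \<open>a\<close> definable over \<open>a\<close> with parameters in \<open>a\<close>.
  The disjunct \<open>x = a\<close> matters only if \<open>a\<close> is empty, when there are no assignments.
\<close>

definition defpow :: "('m \<Rightarrow> 'm \<Rightarrow> bool) \<Rightarrow> 'm \<Rightarrow> 'm \<Rightarrow> bool" where
  "defpow E a x \<longleftrightarrow> x = a \<or>
     (\<exists>r s. (\<forall>D. def_family E a D \<longrightarrow> E r D) \<and> asg E a s \<and>
        (\<forall>y. E y x \<longleftrightarrow> E y a \<and> E (upd E s (emptyset E) y) r))"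

text \<open>
  \<open>L_hierarchy E \<alpha> g\<close>: \<open>g\<close> is the function \<open>\<beta> \<mapsto> L\<^sub>\<beta>\<close> for \<open>\<beta> \<le> \<alpha>\<close>, where \<open>L\<^sub>\<beta>\<close> is the union
  of the definable power sets of all \<open>L\<^sub>\<gamma>\<close> with \<open>\<gamma> < \<beta>\<close>.
\<close>

definition L_hierarchy :: "('m \<Rightarrow> 'm \<Rightarrow> bool) \<Rightarrow> 'm \<Rightarrow> 'm \<Rightarrow> bool" where
  "L_hierarchy E \<alpha> g \<longleftrightarrow> ordinal E \<alpha> \<and> is_fun E g (ext E (succ E \<alpha>)) UNIV \<and>
     (\<forall>\<beta>. E \<beta> (succ E \<alpha>) \<longrightarrow>
        (\<forall>x. E x (fapp E g \<beta>) \<longleftrightarrow> (\<exists>\<gamma>. E \<gamma> \<beta> \<and> defpow E (fapp E g \<gamma>) x)))"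

definition V_eq_L :: "('m \<Rightarrow> 'm \<Rightarrow> bool) \<Rightarrow> bool" where
  "V_eq_L E \<longleftrightarrow> (\<forall>x. \<exists>\<alpha> g. L_hierarchy E \<alpha> g \<and> E x (fapp E g \<alpha>))"

section \<open>Functionals definable in the model\<close>

text \<open>Parameters are allowed, and are supplied by \<open>e\<close>.\<close>

definition definable_functional ::
    "('m \<Rightarrow> 'm \<Rightarrow> bool) \<Rightarrow> nat \<Rightarrow> ('m list \<Rightarrow> 'm) \<Rightarrow> bool" where
  "definable_functional E n g \<longleftrightarrow>
     (\<exists>p e. \<forall>xs y. length xs = n \<longrightarrow> (y = g xs \<longleftrightarrow> sat E (foldr case_nat (y # xs) e) p))"

definition binary :: "('m \<Rightarrow> 'm \<Rightarrow> 'm) \<Rightarrow> 'm list \<Rightarrow> 'm" where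
  "binary f xs = f (xs ! 0) (xs ! 1)"

definition wf_in_model :: "('m \<Rightarrow> 'm \<Rightarrow> bool) \<Rightarrow> ('m \<Rightarrow> 'm \<Rightarrow> bool) \<Rightarrow> bool" where
  "wf_in_model E R \<longleftrightarrow>
     (\<forall>a. (\<exists>x. E x a) \<longrightarrow> (\<exists>y. E y a \<and> \<not> (\<exists>x. E x a \<and> R x y)))"

section \<open>Realizability algebras in the model\<close>

text \<open>
  All components are elements of the model; the five operations are functions in the sense of
  the model, so that they are used through \<open>fapp\<close>.
\<close>

record 'm realg =
  Terms :: 'm
  Stacks :: 'm
  Procs :: 'm
  App :: 'm
  Push :: 'm
  Star :: 'm
  Kont :: 'm
  cB :: 'm
  cC :: 'm
  cI :: 'm
  cK :: 'm
  cW :: 'm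
  cCC :: 'm
  Pole :: 'm
  QP :: 'm

definition app :: "('m \<Rightarrow> 'm \<Rightarrow> bool) \<Rightarrow> 'm realg \<Rightarrow> 'm \<Rightarrow> 'm \<Rightarrow> 'm" where
  "app E A x y = fapp E (App A) (pair E x y)"

definition push :: "('m \<Rightarrow> 'm \<Rightarrow> bool) \<Rightarrow> 'm realg \<Rightarrow> 'm \<Rightarrow> 'm \<Rightarrow> 'm" where
  "push E A x s = fapp E (Push A) (pair E x s)"

definition star :: "('m \<Rightarrow> 'm \<Rightarrow> bool) \<Rightarrow> 'm realg \<Rightarrow> 'm \<Rightarrow> 'm \<Rightarrow> 'm" where
  "star E A x s = fapp E (Star A) (pair E x s)"

definition kont :: "('m \<Rightarrow> 'm \<Rightarrow> bool) \<Rightarrow> 'm realg \<Rightarrow> 'm \<Rightarrow> 'm" where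
  "kont E A s = fapp E (Kont A) s"

definition exec_closed ::
    "('m \<Rightarrow> 'm \<Rightarrow> bool) \<Rightarrow> 'm realg \<Rightarrow> ('m \<Rightarrow> 'm \<Rightarrow> bool) \<Rightarrow> bool" where
  "exec_closed E A R \<longleftrightarrow>
     (let T = ext E (Terms A); S = ext E (Stacks A); P = ext E (Procs A);
          ap = app E A; pu = push E A; st = star E A
      in
       (\<forall>p\<in>P. R p p) \<and>
       (\<forall>p\<in>P. \<forall>q\<in>P. \<forall>r\<in>P. R p q \<longrightarrow> R q r \<longrightarrow> R p r) \<and>
       (\<forall>x\<in>T. \<forall>y\<in>T. \<forall>s\<in>S. R (st (ap x y) s) (st x (pu y s))) \<and>
       (\<forall>x\<in>T. \<forall>s\<in>S. R (st (cI A) (pu x s)) (st x s)) \<and>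
       (\<forall>x\<in>T. \<forall>y\<in>T. \<forall>s\<in>S. R (st (cK A) (pu x (pu y s))) (st x s)) \<and>
       (\<forall>x\<in>T. \<forall>y\<in>T. \<forall>s\<in>S. R (st (cW A) (pu x (pu y s))) (st x (pu y (pu y s)))) \<and>
       (\<forall>x\<in>T. \<forall>y\<in>T. \<forall>z\<in>T. \<forall>s\<in>S.
          R (st (cC A) (pu x (pu y (pu z s)))) (st x (pu z (pu y s)))) \<and>
       (\<forall>x\<in>T. \<forall>y\<in>T. \<forall>z\<in>T. \<forall>s\<in>S.
          R (st (cB A) (pu x (pu y (pu z s)))) (st x (pu (ap y z) s))) \<and>
       (\<forall>x\<in>T. \<forall>s\<in>S. R (st (cCC A) (pu x s)) (st x (pu (kont E A s) s))) \<and>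
       (\<forall>x\<in>T. \<forall>s\<in>S. \<forall>t\<in>S. R (st (kont E A s) (pu x t)) (st x s)))"

text \<open>Execution is the least such relation \<^emph>\<open>of the model\<close>.\<close>

definition exec :: "('m \<Rightarrow> 'm \<Rightarrow> bool) \<Rightarrow> 'm realg \<Rightarrow> 'm \<Rightarrow> 'm \<Rightarrow> bool" where
  "exec E A p q \<longleftrightarrow> E p (Procs A) \<and> E q (Procs A) \<and>
     (\<forall>r. exec_closed E A (\<lambda>u v. E (pair E u v) r) \<longrightarrow> E (pair E p q) r)"

definition realizability_algebra :: "('m \<Rightarrow> 'm \<Rightarrow> bool) \<Rightarrow> 'm realg \<Rightarrow> bool" where
  "realizability_algebra E A \<longleftrightarrow>
     is_fun E (App A) (cart E (Terms A) (Terms A)) (ext E (Terms A)) \<and>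
     is_fun E (Push A) (cart E (Terms A) (Stacks A)) (ext E (Stacks A)) \<and>
     is_fun E (Star A) (cart E (Terms A) (Stacks A)) (ext E (Procs A)) \<and>
     is_fun E (Kont A) (ext E (Stacks A)) (ext E (Terms A)) \<and>
     {cB A, cC A, cI A, cK A, cW A, cCC A} \<subseteq> ext E (Terms A) \<and>
     ext E (Pole A) \<subseteq> ext E (Procs A) \<and>
     (\<forall>x s x' s'. E x (Terms A) \<and> E s (Stacks A) \<and> E x' (Terms A) \<and> E s' (Stacks A) \<and>
        exec E A (star E A x s) (star E A x' s') \<and> E (star E A x' s') (Pole A) \<longrightarrow>
        E (star E A x s) (Pole A)) \<and>
     ext E (QP A) \<subseteq> ext E (Terms A) \<and>
     {cB A, cC A, cI A, cK A, cW A, cCC A} \<subseteq> ext E (QP A) \<and>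
     (\<forall>x y. E x (QP A) \<and> E y (QP A) \<longrightarrow> E (app E A x y) (QP A))"

definition coherent :: "('m \<Rightarrow> 'm \<Rightarrow> bool) \<Rightarrow> 'm realg \<Rightarrow> bool" where
  "coherent E A \<longleftrightarrow>
     (\<forall>t. E t (QP A) \<longrightarrow> (\<exists>s. E s (Stacks A) \<and> \<not> E (star E A t s) (Pole A)))"

text \<open>
  The combinatory term \<open>(W)(B)(BW)(C)B = W(B(BW(CB)))\<close>, which is the translation of
  \<open>\<lambda>a\<lambda>f(f)(a)af\<close>; see \<open>exec_A_term\<close> below.
\<close>

definition A_term :: "('m \<Rightarrow> 'm \<Rightarrow> bool) \<Rightarrow> 'm realg \<Rightarrow> 'm" where
  "A_term E A =
     app E A (cW A)
       (app E A (cB A) (app E A (app E A (cB A) (cW A)) (app E A (cC A) (cB A))))"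

definition Y_term :: "('m \<Rightarrow> 'm \<Rightarrow> bool) \<Rightarrow> 'm realg \<Rightarrow> 'm" where
  "Y_term E A = app E A (A_term E A) (A_term E A)"

section \<open>Formulas of ZF-epsilon and their falsity values\<close>

text \<open>
  A function symbol is the functional that interprets it.  In \<open>Fn g ts\<close> the arity is
  the length of \<open>ts\<close>; definability of \<open>g\<close> is required by \<open>tm_ok\<close>.
\<close>

datatype 'm tm = Var nat | Par 'm | Fn "'m list \<Rightarrow> 'm" "'m tm list"

datatype 'm form =
    Top
  | Bot
  | NEps "'m tm" "'m tm"  \<comment> \<open>negated strong membership, \<open>t \<not>\<epsilon> u\<close>\<close>
  | NIn "'m tm" "'m tm"   \<comment> \<open>\<open>t \<notin> u\<close>\<close>
  | Incl "'m tm" "'m tm"  \<comment> \<open>\<open>t \<subset> u\<close>\<close>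
  | Imp "'m form" "'m form"
  | Univ "'m form"        \<comment> \<open>de Bruijn indices\<close>
  | Hook "'m tm" "'m tm" "'m form"  \<comment> \<open>\<open>t = u \<hookrightarrow> F\<close>; not a formula of ZF-epsilon proper\<close>

primrec teval :: "(nat \<Rightarrow> 'm) \<Rightarrow> 'm tm \<Rightarrow> 'm" where
  "teval e (Var i) = e i"
| "teval e (Par a) = a"
| "teval e (Fn g ts) = g (map (teval e) ts)"

fun tm_ok :: "('m \<Rightarrow> 'm \<Rightarrow> bool) \<Rightarrow> nat \<Rightarrow> 'm tm \<Rightarrow> bool" where
  "tm_ok E n (Var i) \<longleftrightarrow> i < n"
| "tm_ok E n (Par a) \<longleftrightarrow> True"
| "tm_ok E n (Fn g ts) \<longleftrightarrow> definable_functional E (length ts) g \<and> (\<forall>t\<in>set ts. tm_ok E n t)"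

text \<open>
  \<open>zfe_formula E n F\<close>: \<open>F\<close> is a formula of ZF-epsilon with parameters whose free variables
  are among the indices below \<open>n\<close>.
\<close>

primrec zfe_formula :: "('m \<Rightarrow> 'm \<Rightarrow> bool) \<Rightarrow> nat \<Rightarrow> 'm form \<Rightarrow> bool" where
  "zfe_formula E n Top \<longleftrightarrow> True"
| "zfe_formula E n Bot \<longleftrightarrow> True"
| "zfe_formula E n (NEps t u) \<longleftrightarrow> tm_ok E n t \<and> tm_ok E n u"
| "zfe_formula E n (NIn t u) \<longleftrightarrow> tm_ok E n t \<and> tm_ok E n u"
| "zfe_formula E n (Incl t u) \<longleftrightarrow> tm_ok E n t \<and> tm_ok E n u"
| "zfe_formula E n (Imp F G) \<longleftrightarrow> zfe_formula E n F \<and> zfe_formula E n G"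
| "zfe_formula E n (Univ F) \<longleftrightarrow> zfe_formula E (Suc n) F"
| "zfe_formula E n (Hook t u F) \<longleftrightarrow> False"

text \<open>\<open>realizes_value E A x V\<close>: the term \<open>x\<close> realizes a formula with falsity value \<open>V\<close>.\<close>

definition realizes_value ::
    "('m \<Rightarrow> 'm \<Rightarrow> bool) \<Rightarrow> 'm realg \<Rightarrow> 'm \<Rightarrow> 'm set \<Rightarrow> bool" where
  "realizes_value E A x V \<longleftrightarrow> E x (Terms A) \<and> (\<forall>s\<in>V. E (star E A x s) (Pole A))"

text \<open>
  The falsity values of \<open>a \<subset> b\<close> and \<open>a \<notin> b\<close> are defined by simultaneous recursion on ranks.
  As the recursion takes place in the model, it is expressed by its approximations: on a
  transitive set \<open>T\<close>, the sets \<open>i\<close> and \<open>n\<close> tabulate the two functions, by way of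
  \<open>((a, b), s) \<in> i\<close> if and only if the stack \<open>s\<close> belongs to the falsity value of \<open>a \<subset> b\<close>, and
  likewise for \<open>n\<close> and \<open>a \<notin> b\<close>.
\<close>

definition tab :: "('m \<Rightarrow> 'm \<Rightarrow> bool) \<Rightarrow> 'm \<Rightarrow> 'm \<Rightarrow> 'm \<Rightarrow> 'm set" where
  "tab E i a b = {s. E (pair E (pair E a b) s) i}"

definition atomic_approx ::
    "('m \<Rightarrow> 'm \<Rightarrow> bool) \<Rightarrow> 'm realg \<Rightarrow> 'm \<Rightarrow> 'm \<Rightarrow> 'm \<Rightarrow> bool" where
  "atomic_approx E A T i n \<longleftrightarrow> transitive E T \<and>
     (\<forall>a b. E a T \<and> E b T \<longrightarrow>
        tab E i a b =
          {push E A x s | c x s. E s (Stacks A) \<and> E (pair E c s) a \<and>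
             realizes_value E A x (tab E n c b)} \<and>
        tab E n a b =
          {push E A x (push E A x' s) | c x x' s. E s (Stacks A) \<and> E (pair E c s) b \<and>
             realizes_value E A x (tab E i a c) \<and> realizes_value E A x' (tab E i c a)})"

definition falsity_Incl :: "('m \<Rightarrow> 'm \<Rightarrow> bool) \<Rightarrow> 'm realg \<Rightarrow> 'm \<Rightarrow> 'm \<Rightarrow> 'm set" where
  "falsity_Incl E A a b =
     {s. \<exists>T i n. atomic_approx E A T i n \<and> E a T \<and> E b T \<and> s \<in> tab E i a b}"

definition falsity_NIn :: "('m \<Rightarrow> 'm \<Rightarrow> bool) \<Rightarrow> 'm realg \<Rightarrow> 'm \<Rightarrow> 'm \<Rightarrow> 'm set" where
  "falsity_NIn E A a b =
     {s. \<exists>T i n. atomic_approx E A T i n \<and> E a T \<and> E b T \<and> s \<in> tab E n a b}"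

primrec falsity ::
    "('m \<Rightarrow> 'm \<Rightarrow> bool) \<Rightarrow> 'm realg \<Rightarrow> (nat \<Rightarrow> 'm) \<Rightarrow> 'm form \<Rightarrow> 'm set" where
  "falsity E A e Top = {}"
| "falsity E A e Bot = ext E (Stacks A)"
| "falsity E A e (NEps t u) = {s. E s (Stacks A) \<and> E (pair E (teval e t) s) (teval e u)}"
| "falsity E A e (NIn t u) = falsity_NIn E A (teval e t) (teval e u)"
| "falsity E A e (Incl t u) = falsity_Incl E A (teval e t) (teval e u)"
| "falsity E A e (Imp F G) =
     {push E A x s | x s. realizes_value E A x (falsity E A e F) \<and> s \<in> falsity E A e G}"
| "falsity E A e (Univ F) = (\<Union>a. falsity E A (case_nat a e) F)"
| "falsity E A e (Hook t u F) = (if teval e t = teval e u then falsity E A e F else {})"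

text \<open>For a closed formula the environment is irrelevant.\<close>

definition realizes :: "('m \<Rightarrow> 'm \<Rightarrow> bool) \<Rightarrow> 'm realg \<Rightarrow> 'm \<Rightarrow> 'm form \<Rightarrow> bool" where
  "realizes E A x F \<longleftrightarrow> (\<forall>e. realizes_value E A x (falsity E A e F))"

section \<open>The reduction of the combinator\<close>

text \<open>
  The term \<open>A\<close> has the reduction that characterizes the translation of \<open>\<lambda>a\<lambda>f(f)(a)af\<close>.
\<close>

lemma upair_iff:
  assumes "ZF E"
  shows "E x (upair E a b) \<longleftrightarrow> x = a \<or> x = b"
proof -
  have ext: "\<forall>a b. (\<forall>x. E x a \<longleftrightarrow> E x b) \<longrightarrow> a = b"
    using assms unfolding ZF_def by (elim conjE)
  have "\<forall>a b. \<exists>c. \<forall>x. E x c \<longleftrightarrow> x = a \<or> x = b"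
    using assms unfolding ZF_def by (elim conjE)
  then obtain c where c: "\<forall>x. E x c \<longleftrightarrow> x = a \<or> x = b" by blast
  then have "\<exists>!c. \<forall>x. E x c \<longleftrightarrow> x = a \<or> x = b"
    by (intro ex1I[of _ c]) (auto intro: ext[rule_format])
  from theI'[OF this] show ?thesis unfolding upair_def by blast
qed

lemma upair_eq:
  assumes "ZF E" "upair E a b = upair E c d"
  shows "(a = c \<and> b = d) \<or> (a = d \<and> b = c)"
proof -
  have "\<And>x. x = a \<or> x = b \<longleftrightarrow> x = c \<or> x = d"
    using upair_iff[OF assms(1)] assms(2) by metis
  then show ?thesis by metis
qed

lemma pair_inj:
  assumes "ZF E" "pair E a b = pair E c d"
  shows "a = c \<and> b = d"
  using upair_eq[OF assms(1) assms(2)[unfolded pair_def]]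
    upair_eq[OF assms(1), of a a c c] upair_eq[OF assms(1), of a b c d]
    upair_eq[OF assms(1), of a a c d] upair_eq[OF assms(1), of a b c c]
  by auto

lemma fapp_in:
  assumes "ZF E" "is_fun E f D (ext E R)" "x \<in> D"
  shows "E (fapp E f x) R"
proof -
  from assms have "\<exists>!y. E (pair E x y) f" by (simp add: is_fun_def)
  then have "E (pair E x (fapp E f x)) f" unfolding fapp_def by (rule theI')
  then obtain u v where "v \<in> ext E R" "pair E x (fapp E f x) = pair E u v"
    using assms(2) unfolding is_fun_def by blast
  with pair_inj[OF assms(1)] show ?thesis by (metis ext_def mem_Collect_eq)
qed

lemma exec_A_term:
  assumes ZF: "ZF E" and alg: "realizability_algebra E A"
    and x: "E x (Terms A)" and y: "E y (Terms A)" and s: "E s (Stacks A)"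
  shows "exec E A (star E A (A_term E A) (push E A x (push E A y s)))
                  (star E A y (push E A (app E A (app E A x x) y) s))"
proof -
  let ?T = "\<lambda>t. E t (Terms A)" and ?S = "\<lambda>t. E t (Stacks A)" and ?P = "\<lambda>t. E t (Procs A)"
  have a [intro]: "?T (app E A t u)" if "?T t" "?T u" for t u
  proof -
    have "is_fun E (App A) (cart E (Terms A) (Terms A)) (ext E (Terms A))"
      using alg by (simp add: realizability_algebra_def)
    from fapp_in[OF ZF this] that show ?thesis by (auto simp: app_def cart_def)
  qed
  have p [intro]: "?S (push E A t u)" if "?T t" "?S u" for t u
  proof -
    have "is_fun E (Push A) (cart E (Terms A) (Stacks A)) (ext E (Stacks A))"
      using alg by (simp add: realizability_algebra_def)
    from fapp_in[OF ZF this] that show ?thesis by (auto simp: push_def cart_def)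
  qed
  have st [intro]: "?P (star E A t u)" if "?T t" "?S u" for t u
  proof -
    have "is_fun E (Star A) (cart E (Terms A) (Stacks A)) (ext E (Procs A))"
      using alg by (simp add: realizability_algebra_def)
    from fapp_in[OF ZF this] that show ?thesis by (auto simp: star_def cart_def)
  qed
  have c [intro]: "?T (cB A)" "?T (cC A)" "?T (cW A)"
    using alg by (simp_all add: realizability_algebra_def ext_def)
  let ?b = "cB A" and ?c = "cC A" and ?w = "cW A"
  let ?ap = "app E A" and ?pu = "push E A" and ?st = "star E A"
  let ?bw = "?ap ?b ?w" and ?cb = "?ap ?c ?b" and ?xx = "?ap x x"
  let ?v = "?ap ?bw ?cb" and ?ys = "?pu y s"
  show ?thesis
    unfolding exec_def
  proof (intro conjI allI impI)
    fix r
    define R where "R = (\<lambda>u v. E (pair E u v) r)"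
    assume "exec_closed E A (\<lambda>u v. E (pair E u v) r)"
    then have cl: "exec_closed E A R" by (simp add: R_def)
    have "\<forall>u\<in>ext E (Procs A). \<forall>v\<in>ext E (Procs A). \<forall>w\<in>ext E (Procs A).
        R u v \<longrightarrow> R v w \<longrightarrow> R u w"
      using cl unfolding exec_closed_def Let_def by (elim conjE)
    then have tr: "R u w" if "R u v" "R v w" "?P u" "?P v" "?P w" for u v w
      using that unfolding ext_def by blast
    have ra: "R (?st (?ap t u) q) (?st t (?pu u q))" if "?T t" "?T u" "?S q" for t u q
      using cl that by (simp add: exec_closed_def Let_def ext_def)
    have rw: "R (?st ?w (?pu t (?pu u q))) (?st t (?pu u (?pu u q)))"
      if "?T t" "?T u" "?S q" for t u q
      using cl that by (simp add: exec_closed_def Let_def ext_def)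
    have rc: "R (?st ?c (?pu t (?pu u (?pu v q)))) (?st t (?pu v (?pu u q)))"
      if "?T t" "?T u" "?T v" "?S q" for t u v q
      using cl that by (simp add: exec_closed_def Let_def ext_def)
    have rb: "R (?st ?b (?pu t (?pu u (?pu v q)))) (?st t (?pu (?ap u v) q))"
      if "?T t" "?T u" "?T v" "?S q" for t u v q
      using cl that by (simp add: exec_closed_def Let_def ext_def)
    let ?g = "?st y (?pu (?ap ?xx y) s)"
    note i = a p st c x y s
    have r1: "R (?st ?b (?pu y (?pu ?xx ?ys))) ?g"
      by (rule rb; intro i)
    have r2: "R (?st (?ap ?c ?b) (?pu ?xx (?pu y ?ys))) ?g"
      by (rule tr[OF ra tr[OF rc r1]]; intro i)
    have r3: "R (?st (?ap ?cb ?xx) (?pu y ?ys)) ?g"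
      by (rule tr[OF ra r2]; intro i)
    have r4: "R (?st ?w (?pu (?ap ?cb ?xx) ?ys)) ?g"
      by (rule tr[OF rw r3]; intro i)
    have r5: "R (?st ?b (?pu ?w (?pu ?cb (?pu ?xx ?ys)))) ?g"
      by (rule tr[OF rb r4]; intro i)
    have r6: "R (?st ?bw (?pu ?cb (?pu ?xx ?ys))) ?g"
      by (rule tr[OF ra r5]; intro i)
    have r7: "R (?st ?v (?pu ?xx ?ys)) ?g"
      by (rule tr[OF ra r6]; intro i)
    have r8: "R (?st ?b (?pu ?v (?pu x (?pu x ?ys)))) ?g"
      by (rule tr[OF rb r7]; intro i)
    have r9: "R (?st (?ap ?b ?v) (?pu x (?pu x ?ys))) ?g"
      by (rule tr[OF ra r8]; intro i)
    have r10: "R (?st ?w (?pu (?ap ?b ?v) (?pu x ?ys))) ?g"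
      by (rule tr[OF rw r9]; intro i)
    have r11: "R (?st (A_term E A) (?pu x ?ys)) ?g"
      unfolding A_term_def by (rule tr[OF ra r10]; intro i)
    then show "E (pair E (?st (A_term E A) (?pu x ?ys)) ?g) r" by (simp add: R_def)
  qed (simp_all add: A_term_def a p st c x y s)
qed

end

theory Submission
  imports Defs
begin

text \<open>
  Suppose that \<open>\<xi>\<close> realizes the hypothesis, and let \<open>C\<close> be the class of all \<open>y\<close> such that
  \<open>Y \<star> \<xi> \<cdot> \<pi> \<notin> \<bottom>\<close> for some \<open>\<pi> \<in> \<parallel>F[y]\<parallel>\<close>.  If \<open>y\<close> is a minimal element of \<open>C\<close>, then \<open>(Y)\<xi>\<close> realizes
  \<open>f(x,y) = 1 \<hookrightarrow> F[x]\<close> for all \<open>x\<close>, so \<open>\<xi> \<star> (Y)\<xi> \<cdot> \<pi> \<in> \<bottom>\<close>, and \<open>Y \<star> \<xi> \<cdot> \<pi>\<close> reduces to this process; a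
  contradiction.  Hence \<open>C\<close> is empty, provided that nonempty classes have minimal elements.

  Well-foundedness in the model speaks about sets of the model only, and \<open>C\<close> is a class.
  So the falsity values have to be definable in the model, and minimal elements of definable
  classes have to be obtained from those of sets.
\<close>

section \<open>Definable predicates\<close>

primrec rename :: "(nat \<Rightarrow> nat) \<Rightarrow> fm \<Rightarrow> fm" where
  "rename r (Mem i j) = Mem (r i) (r j)"
| "rename r (Equ i j) = Equ (r i) (r j)"
| "rename r (Neg p) = Neg (rename r p)"
| "rename r (Con p q) = Con (rename r p) (rename r q)"
| "rename r (Forall p) = Forall (rename (case_nat 0 (\<lambda>i. Suc (r i))) p)"

lemma sat_rename: "sat E e (rename r p) \<longleftrightarrow> sat E (\<lambda>i. e (r i)) p"
proof (induction p arbitrary: e r)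
  case (Forall p)
  have "(\<lambda>i. case_nat a e (case_nat 0 (\<lambda>i. Suc (r i)) i)) = case_nat a (\<lambda>i. e (r i))" for a
    by (auto split: nat.split)
  then show ?case by (simp add: Forall)
qed auto

definition slot :: "((nat \<Rightarrow> 'm) \<Rightarrow> 'm) \<Rightarrow> bool" where
  "slot v \<longleftrightarrow> (\<exists>j. v = (\<lambda>e. e j)) \<or> (\<exists>a. v = (\<lambda>e. a))"

text \<open>
  Letting each variable of the formula stand for a coordinate of the environment or for a
  parameter makes definability closed under conjunction without any bookkeeping of free
  variables: the variables of the two conjuncts are renamed to the even and the odd numbers.
\<close>

definition dfn :: "('m \<Rightarrow> 'm \<Rightarrow> bool) \<Rightarrow> ((nat \<Rightarrow> 'm) \<Rightarrow> bool) \<Rightarrow> bool" where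
  "dfn E P \<longleftrightarrow> (\<exists>p v. (\<forall>i. slot (v i)) \<and> (\<forall>e. P e \<longleftrightarrow> sat E (\<lambda>i. v i e) p))"

text \<open>\<open>fm\<close> has no function symbols, so a term is represented by its graph, with
  the value at coordinate 0 and the environment of the term shifted by one.\<close>

definition tdef :: "('m \<Rightarrow> 'm \<Rightarrow> bool) \<Rightarrow> ((nat \<Rightarrow> 'm) \<Rightarrow> 'm) \<Rightarrow> bool" where
  "tdef E t \<longleftrightarrow> dfn E (\<lambda>e. e 0 = t (\<lambda>i. e (Suc i)))"

lemma slot_proj [simp]: "slot (\<lambda>e. e j)"
  by (auto simp: slot_def)

lemma slot_const [simp]: "slot (\<lambda>e. a)"
  by (auto simp: slot_def)

lemma dfnI: "(\<And>i. slot (v i)) \<Longrightarrow> (\<And>e. P e \<longleftrightarrow> sat E (\<lambda>i. v i e) p) \<Longrightarrow> dfn E P"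
  unfolding dfn_def by blast

lemma dfn_subst:
  assumes "dfn E P" "\<And>i. slot (v i)"
  shows "dfn E (\<lambda>e. P (\<lambda>i. v i e))"
proof -
  obtain p w where w: "\<And>i. slot (w i)" "\<And>e. P e \<longleftrightarrow> sat E (\<lambda>i. w i e) p"
    using assms(1) unfolding dfn_def by blast
  have "slot (\<lambda>e. w i (\<lambda>i. v i e))" for i
    using w(1)[of i] assms(2) unfolding slot_def[of "w i"] by auto
  then show ?thesis by (rule dfnI[of "\<lambda>i e. w i (\<lambda>i. v i e)"]) (simp add: w(2))
qed

lemma dfn_shift: "dfn E P \<Longrightarrow> dfn E (\<lambda>e. P (\<lambda>i. e (r i)))"
  using dfn_subst[of E P "\<lambda>i e. e (r i)"] by simp

text \<open>To bind coordinate 0, all variables standing for it must be merged into variable 0; the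
  remaining ones keep their slots.\<close>

lemma dfn_bind:
  assumes "dfn E P"
  obtains p v where "\<And>i. slot (v i)"
    "\<And>a e. P (case_nat a e) \<longleftrightarrow> sat E (case_nat a (\<lambda>i. v i e)) p"
proof -
  obtain p w where w: "\<And>i. slot (w i)" "\<And>e. P e \<longleftrightarrow> sat E (\<lambda>i. w i e) p"
    using assms(1) unfolding dfn_def by blast
  define r where "r i = (if w i = (\<lambda>e. e 0) then 0 else Suc i)" for i
  \<comment> \<open>The default is harmless: a slot other than coordinate 0 ignores it, and
    \<open>r\<close> avoids \<open>v i\<close> when \<open>w i\<close> is coordinate 0.\<close>
  define v where "v i = (\<lambda>e. w i (case_nat undefined e))" for i
  have "slot (v i)" for i
  proof -
    consider j where "w i = (\<lambda>e. e j)" | a where "w i = (\<lambda>e. a)"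
      using w(1)[of i] by (auto simp: slot_def)
    then show ?thesis
    proof cases
      case 1
      then show ?thesis by (cases j) (simp_all add: v_def)
    qed (simp add: v_def)
  qed
  moreover have "w i (case_nat a e) = case_nat a (\<lambda>i. v i e) (r i)" for a e i
  proof -
    consider "w i = (\<lambda>e. e 0)" | j where "w i \<noteq> (\<lambda>e. e 0)" "w i = (\<lambda>e. e (Suc j))"
      | b where "w i \<noteq> (\<lambda>e. e 0)" "w i = (\<lambda>e. b)"
      using w(1)[of i] unfolding slot_def by (metis not0_implies_Suc)
    then show ?thesis by cases (simp_all add: v_def r_def)
  qed
  ultimately show thesis by (intro that[of v "rename r p"]) (simp_all add: w(2) sat_rename)
qed

section \<open>Closure under connectives and quantifiers\<close>

named_theorems dfn_intros

lemma dfn_neg [dfn_intros]: "dfn E P \<Longrightarrow> dfn E (\<lambda>e. \<not> P e)"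
  unfolding dfn_def by (metis sat.simps(3))

lemma dfn_conj [dfn_intros]:
  assumes "dfn E P" "dfn E Q"
  shows "dfn E (\<lambda>e. P e \<and> Q e)"
proof -
  obtain p v where v: "\<And>i. slot (v i)" "\<And>e. P e \<longleftrightarrow> sat E (\<lambda>i. v i e) p"
    using assms(1) unfolding dfn_def by blast
  obtain q w where w: "\<And>i. slot (w i)" "\<And>e. Q e \<longleftrightarrow> sat E (\<lambda>i. w i e) q"
    using assms(2) unfolding dfn_def by blast
  show ?thesis
    by (rule dfnI[of "\<lambda>i. if even i then v (i div 2) else w (i div 2)" _ _
          "Con (rename (\<lambda>i. 2 * i) p) (rename (\<lambda>i. Suc (2 * i)) q)"])
      (auto simp: v w sat_rename)
qed

text \<open>The coordinates are spelled out in the premise so that backward application by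
  higher-order unification can descend through nested quantifiers.\<close>

lemma dfn_all [dfn_intros]:
  assumes "dfn E (\<lambda>e. Q (e 0) (\<lambda>i. e (Suc i)))"
  shows "dfn E (\<lambda>e. \<forall>a. Q a e)"
proof -
  obtain p v where v: "\<And>i. slot (v i)"
    and eq: "\<And>a e. Q (case_nat a e 0) (\<lambda>i. case_nat a e (Suc i)) \<longleftrightarrow>
      sat E (case_nat a (\<lambda>i. v i e)) p"
    using dfn_bind[OF assms] by metis
  show ?thesis
    by (rule dfnI[of v _ _ "Forall p"]) (use eq in \<open>simp_all add: v\<close>)
qed

lemma dfn_const [dfn_intros]: "dfn E (\<lambda>e. b)"
proof -
  have T: "dfn E (\<lambda>e. True)" by (rule dfnI[of "\<lambda>i e. e i" _ _ "Equ 0 0"]) simp_all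
  show ?thesis using T dfn_neg[OF T] by (cases b) simp_all
qed

lemma dfn_ex [dfn_intros]:
  assumes "dfn E (\<lambda>e. Q (e 0) (\<lambda>i. e (Suc i)))"
  shows "dfn E (\<lambda>e. \<exists>a. Q a e)"
  using dfn_neg[OF dfn_all[of E "\<lambda>a e. \<not> Q a e", OF dfn_neg[OF assms]]] by simp

lemma dfn_disj [dfn_intros]: "dfn E P \<Longrightarrow> dfn E Q \<Longrightarrow> dfn E (\<lambda>e. P e \<or> Q e)"
  using dfn_neg[OF dfn_conj[OF dfn_neg[of E P] dfn_neg[of E Q]]] by simp

lemma dfn_imp [dfn_intros]: "dfn E P \<Longrightarrow> dfn E Q \<Longrightarrow> dfn E (\<lambda>e. P e \<longrightarrow> Q e)"
  unfolding imp_conv_disj by (intro dfn_disj dfn_neg)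

lemma dfn_iff [dfn_intros]: "dfn E P \<Longrightarrow> dfn E Q \<Longrightarrow> dfn E (\<lambda>e. P e \<longleftrightarrow> Q e)"
  unfolding iff_conv_conj_imp by (intro dfn_conj dfn_imp)

section \<open>Definable terms and their substitution\<close>

lemma tdef_shift: "tdef E t \<Longrightarrow> tdef E (\<lambda>e. t (\<lambda>i. e (r i)))"
  using dfn_shift[of E "\<lambda>e. e 0 = t (\<lambda>i. e (Suc i))" "case_nat 0 (\<lambda>i. Suc (r i))"]
  by (simp add: tdef_def)

text \<open>One-point rule: \<open>Q (t e) e\<close> holds iff some \<open>y\<close> satisfies
  \<open>y = t e\<close> and \<open>Q y e\<close>.\<close>

lemma dfn_term:
  assumes "tdef E t" "dfn E (\<lambda>e. Q (e 0) (\<lambda>i. e (Suc i)))"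
  shows "dfn E (\<lambda>e. Q (t e) e)"
  using dfn_ex[of E "\<lambda>y e. y = t e \<and> Q y e", OF dfn_conj[OF assms(1)[unfolded tdef_def] assms(2)]]
  by simp

lemma dfn_app1:
  assumes "dfn E (\<lambda>e. P (e 0))" "tdef E s"
  shows "dfn E (\<lambda>e. P (s e))"
  by (rule dfn_term[OF assms(2)]) (rule assms(1))

lemma dfn_app2:
  assumes "dfn E (\<lambda>e. P (e 0) (e (Suc 0)))" "tdef E s" "tdef E t"
  shows "dfn E (\<lambda>e. P (s e) (t e))"
proof (rule dfn_term[OF assms(2)])
  show "dfn E (\<lambda>e. P (e 0) (t (\<lambda>i. e (Suc i))))"
    using dfn_term[OF tdef_shift[OF assms(3)], of "\<lambda>y e. P (e 0) y" Suc]
      dfn_shift[OF assms(1), of "\<lambda>i. if i = 0 then 1 else 0"] by simp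
qed

lemma tdef_var [dfn_intros]: "tdef E (\<lambda>e. e i)"
  unfolding tdef_def by (rule dfnI[of "\<lambda>i e. e i" _ _ "Equ 0 (Suc i)"]) simp_all

lemma tdef_par [dfn_intros]: "tdef E (\<lambda>e. a)"
  unfolding tdef_def by (rule dfnI[of "case_nat (\<lambda>e. e 0) (\<lambda>i e. a)" _ _ "Equ 0 1"])
    (auto split: nat.split)

lemma dfn_mem [dfn_intros]: "tdef E s \<Longrightarrow> tdef E t \<Longrightarrow> dfn E (\<lambda>e. E (s e) (t e))"
  by (rule dfn_app2) (rule dfnI[of "\<lambda>i e. e i" _ _ "Mem 0 1"], simp_all)

lemma dfn_eq [dfn_intros]: "tdef E s \<Longrightarrow> tdef E t \<Longrightarrow> dfn E (\<lambda>e. s e = t e)"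
  by (rule dfn_app2) (rule dfnI[of "\<lambda>i e. e i" _ _ "Equ 0 1"], simp_all)

lemma dfn_ex1 [dfn_intros]:
  assumes "dfn E (\<lambda>e. Q (e 0) (\<lambda>i. e (Suc i)))"
  shows "dfn E (\<lambda>e. \<exists>!a. Q a e)"
proof -
  \<comment> \<open>Below both quantifiers \<open>a\<close> is coordinate 0 and \<open>b\<close> is
    coordinate 1, so the environment of \<open>Q\<close> skips coordinate 1.\<close>
  have "dfn E (\<lambda>e. \<exists>b. \<forall>a. Q a e \<longleftrightarrow> a = b)"
    by (intro dfn_intros) (use dfn_shift[OF assms, of "case_nat 0 (\<lambda>i. Suc (Suc i))"] in simp)
  also have "(\<lambda>e. \<exists>b. \<forall>a. Q a e \<longleftrightarrow> a = b) = (\<lambda>e. \<exists>!a. Q a e)" by (auto simp: fun_eq_iff)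
  finally show ?thesis .
qed

section \<open>Set theory in the model\<close>

locale zf_model =
  fixes E :: "'m \<Rightarrow> 'm \<Rightarrow> bool"
  assumes ZF: "ZF E"
begin

section \<open>The axioms in usable form\<close>

lemma set_eqI: "(\<And>x. E x a \<longleftrightarrow> E x b) \<Longrightarrow> a = b"
  using ZF unfolding ZF_def by (elim conjE) blast

lemma foundation:
  assumes "E x a"
  obtains y where "E y a" "\<And>z. E z y \<Longrightarrow> \<not> E z a"
proof -
  have "\<forall>a. (\<exists>x. E x a) \<longrightarrow> (\<exists>x. E x a \<and> \<not> (\<exists>y. E y x \<and> E y a))"
    using ZF unfolding ZF_def by (elim conjE)
  then show thesis using assms that by blast
qed

lemma union_ex: "\<exists>u. \<forall>x. E x u \<longleftrightarrow> (\<exists>y. E x y \<and> E y a)"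
proof -
  have "\<forall>a. \<exists>u. \<forall>x. E x u \<longleftrightarrow> (\<exists>y. E x y \<and> E y a)"
    using ZF unfolding ZF_def by (elim conjE)
  then show ?thesis ..
qed

lemma power_ex: "\<exists>p. \<forall>x. E x p \<longleftrightarrow> (\<forall>y. E y x \<longrightarrow> E y a)"
proof -
  have "\<forall>a. \<exists>p. \<forall>x. E x p \<longleftrightarrow> (\<forall>y. E y x \<longrightarrow> E y a)"
    using ZF unfolding ZF_def by (elim conjE)
  then show ?thesis ..
qed

lemma separation:
  assumes "dfn E (\<lambda>e. P (e 0))"
  shows "\<exists>b. \<forall>x. E x b \<longleftrightarrow> E x a \<and> P x"
proof -
  obtain p v where "\<And>a e. P (case_nat a e 0) \<longleftrightarrow> sat E (case_nat a (\<lambda>i. v i e)) p"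
    using dfn_bind[OF assms] by metis
  then have "P x \<longleftrightarrow> sat E (case_nat x (\<lambda>i. v i undefined)) p" for x by simp
  moreover have "\<forall>p e a. \<exists>b. \<forall>x. E x b \<longleftrightarrow> E x a \<and> sat E (case_nat x e) p"
    using ZF unfolding ZF_def by (elim conjE)
  ultimately show ?thesis by presburger
qed

lemma replacement:
  assumes "dfn E (\<lambda>e. P (e 0) (e (Suc 0)))" and "\<And>x. E x a \<Longrightarrow> \<exists>!y. P x y"
  shows "\<exists>b. \<forall>y. E y b \<longleftrightarrow> (\<exists>x. E x a \<and> P x y)"
proof -
  obtain p v where v: "\<And>i. slot (v i)"
    and p: "\<And>e. P (e 0) (e (Suc 0)) \<longleftrightarrow> sat E (\<lambda>i. v i e) p"
    using assms(1) unfolding dfn_def by blast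
  \<comment> \<open>Variable 0 is the argument and variable 1 the value; the others move past both.
    Further coordinates are irrelevant to \<open>P\<close> and are fixed arbitrarily in
    \<open>u\<close>.\<close>
  define r where "r i = (if v i = (\<lambda>e. e 0) then 0
    else if v i = (\<lambda>e. e (Suc 0)) then 1 else Suc (Suc i))" for i
  define u where "u i = v i (\<lambda>_. undefined)" for i
  have "v i (case_nat x (case_nat y (\<lambda>_. undefined))) = case_nat x (case_nat y u) (r i)" for x y i
  proof -
    consider "v i = (\<lambda>e. e 0)" | "v i \<noteq> (\<lambda>e. e 0)" "v i = (\<lambda>e. e (Suc 0))"
      | "v i \<noteq> (\<lambda>e. e 0)" "v i \<noteq> (\<lambda>e. e (Suc 0))" by blast
    then show ?thesis
    proof cases
      case 3
      then consider j where "v i = (\<lambda>e. e (Suc (Suc j)))" | a where "v i = (\<lambda>e. a)"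
        using v[of i] unfolding slot_def by (metis not0_implies_Suc)
      then show ?thesis
      proof cases
        case 1
        then show ?thesis using 3 by (auto simp: r_def u_def)
      next
        case 2
        then show ?thesis using 3 by (simp add: r_def u_def)
      qed
    qed (auto simp: r_def)
  qed
  then have P: "P x y \<longleftrightarrow> sat E (case_nat x (case_nat y u)) (rename r p)" for x y
    using p[of "case_nat x (case_nat y (\<lambda>_. undefined))"] by (simp add: sat_rename)
  have "\<forall>p e a. (\<forall>x. E x a \<longrightarrow> (\<exists>!y. sat E (case_nat x (case_nat y e)) p)) \<longrightarrow>
        (\<exists>b. \<forall>y. E y b \<longleftrightarrow> (\<exists>x. E x a \<and> sat E (case_nat x (case_nat y e)) p))"
    using ZF unfolding ZF_def by (elim conjE)
  from this[rule_format, of a u "rename r p"] assms(2) show ?thesis unfolding P by blast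
qed

lemma mem_asym: "E a b \<Longrightarrow> \<not> E b a"
  by (rule foundation[of a "upair E a b"]) (auto simp: upair_iff[OF ZF])

lemma insert_ex: "\<exists>b. \<forall>x. E x b \<longleftrightarrow> E x a \<or> x = y"
proof -
  obtain b where "\<And>x. E x b \<longleftrightarrow> (\<exists>z. E x z \<and> E z (upair E a (upair E y y)))"
    using union_ex by metis
  then have "E x b \<longleftrightarrow> E x a \<or> x = y" for x using upair_iff[OF ZF] by metis
  then show ?thesis by blast
qed

lemma succ_iff: "E x (succ E a) \<longleftrightarrow> E x a \<or> x = a"
proof -
  obtain b where b: "\<forall>x. E x b \<longleftrightarrow> E x a \<or> x = a" using insert_ex by blast
  then have "\<exists>!b. \<forall>x. E x b \<longleftrightarrow> E x a \<or> x = a"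
    by (intro ex1I[of _ b]) (auto intro: set_eqI)
  from theI'[OF this] show ?thesis unfolding succ_def by blast
qed

lemma succ_inject: "succ E a = succ E b \<Longrightarrow> a = b"
  by (metis succ_iff mem_asym)

lemma succ_ext: "y = succ E a \<longleftrightarrow> (\<forall>x. E x y \<longleftrightarrow> E x a \<or> x = a)"
  using set_eqI succ_iff by metis

lemma upair_ext: "y = upair E a b \<longleftrightarrow> (\<forall>x. E x y \<longleftrightarrow> x = a \<or> x = b)"
  using set_eqI upair_iff[OF ZF] by metis

lemma tdef_succ [dfn_intros]:
  assumes "tdef E t"
  shows "tdef E (\<lambda>e. succ E (t e))"
  unfolding tdef_def succ_ext by (intro dfn_intros tdef_shift[OF assms])

lemma tdef_upair [dfn_intros]:
  assumes "tdef E s" "tdef E t"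
  shows "tdef E (\<lambda>e. upair E (s e) (t e))"
  unfolding tdef_def upair_ext
  by (intro dfn_intros tdef_shift[OF assms(1)] tdef_shift[OF assms(2)])

lemma tdef_pair [dfn_intros]: "tdef E s \<Longrightarrow> tdef E t \<Longrightarrow> tdef E (\<lambda>e. pair E (s e) (t e))"
  unfolding pair_def by (intro dfn_intros)

section \<open>Iteration of class functionals\<close>

lemma infinity:
  obtains w z where "\<And>x. \<not> E x z" "E z w" "\<And>x. E x w \<Longrightarrow> E (succ E x) w"
proof -
  have "\<exists>w. (\<exists>z. (\<forall>x. \<not> E x z) \<and> E z w) \<and>
          (\<forall>x. E x w \<longrightarrow> (\<exists>y. (\<forall>z. E z y \<longleftrightarrow> E z x \<or> z = x) \<and> E y w))"
    using ZF unfolding ZF_def by (elim conjE)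
  then show thesis unfolding succ_ext[symmetric] using that by blast
qed

text \<open>The set \<open>S\<close> consists of the iterates of \<open>G\<close> on
  \<open>a\<close>. As \<open>G\<close> is a class, the iterates are defined through attempts, sets
  of pairs that approximate the recursion.\<close>

lemma closure_under_functional:
  assumes G: "dfn E (\<lambda>e. G (e 0) (e (Suc 0)))" and fn: "\<And>x. \<exists>!y. G x y"
  obtains S where "E a S" "\<And>x. E x S \<Longrightarrow> \<exists>y. E y S \<and> G x y"
proof -
  note [dfn_intros] = dfn_app2[OF G]
  obtain w z where z: "\<And>x. \<not> E x z" and w: "E z w" "\<And>x. E x w \<Longrightarrow> E (succ E x) w"
    by (rule infinity) (rule that)
  \<comment> \<open>Every pair in an attempt is the starting pair or is justified by an earlier pair
    in the same set; single-valuedness is not demanded.\<close>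
  define att where "att h \<longleftrightarrow> (\<forall>p. E p h \<longrightarrow> p = pair E z a \<or>
    (\<exists>m u v. E (pair E m u) h \<and> G u v \<and> p = pair E (succ E m) v))" for h
  define it where "it n y \<longleftrightarrow> (\<exists>h. att h \<and> E (pair E n y) h)" for n y
  have z_neq: "z \<noteq> succ E m" "succ E m \<noteq> z" for m using z succ_iff by metis+
  have it_z: "it z y \<longleftrightarrow> y = a" for y
  proof
    show "y = a" if "it z y"
      using that z_neq unfolding it_def att_def by (metis pair_inj[OF ZF])
    obtain h where "\<And>p. E p h \<longleftrightarrow> E p z \<or> p = pair E z a" using insert_ex by metis
    then show "it z y" if "y = a"
      unfolding it_def att_def using that z by (intro exI[of _ h]) simp
  qed
  have it_succ: "it (succ E n) y \<longleftrightarrow> (\<exists>u. it n u \<and> G u y)" for n y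
  proof
    show "\<exists>u. it n u \<and> G u y" if "it (succ E n) y"
    proof -
      from that obtain h where h: "att h" "E (pair E (succ E n) y) h" unfolding it_def by blast
      then obtain m u v where m: "E (pair E m u) h" "G u v"
        "pair E (succ E n) y = pair E (succ E m) v"
        unfolding att_def using pair_inj[OF ZF] z_neq by metis
      then have "m = n" "v = y" using pair_inj[OF ZF m(3)] succ_inject by auto
      then show ?thesis using m h(1) unfolding it_def by blast
    qed
    show "it (succ E n) y" if "\<exists>u. it n u \<and> G u y"
    proof -
      from that obtain h u where h: "att h" "E (pair E n u) h" "G u y" unfolding it_def by blast
      obtain k where k: "\<And>p. E p k \<longleftrightarrow> E p h \<or> p = pair E (succ E n) y" using insert_ex by metis
      have "att k" unfolding att_def
      proof (intro allI impI)
        fix p assume "E p k"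
        then consider "E p h" | "p = pair E (succ E n) y" using k by blast
        then show "p = pair E z a \<or>
          (\<exists>m u v. E (pair E m u) k \<and> G u v \<and> p = pair E (succ E m) v)"
        proof cases
          case 1
          then show ?thesis using h(1) k unfolding att_def by metis
        next
          case 2
          then show ?thesis using h(2,3) k by blast
        qed
      qed
      then show ?thesis using k unfolding it_def by blast
    qed
  qed
  have it_dfn: "dfn E (\<lambda>e. it (e 0) (e (Suc 0)))"
    unfolding it_def att_def by (intro dfn_intros)
  note [dfn_intros] = dfn_app2[OF it_dfn]
  have "dfn E (\<lambda>e. \<exists>!y. it (e 0) y)" by (intro dfn_intros)
  \<comment> \<open>\<open>w\<close> may be larger than the set of numerals. Separating the indices
    with exactly one value, a set closed under successor, replaces an induction.\<close>
  then obtain d where d: "\<And>n. E n d \<longleftrightarrow> E n w \<and> (\<exists>!y. it n y)"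
    using separation[of "\<lambda>n. \<exists>!y. it n y" w] by blast
  have "E z d" by (simp add: d w it_z)
  have d_succ: "E (succ E n) d" if "E n d" for n
  proof -
    have "\<exists>!y. it n y" using that d by blast
    then obtain u where "\<And>v. it n v \<longleftrightarrow> v = u" by blast
    then have "it (succ E n) y \<longleftrightarrow> G u y" for y by (auto simp: it_succ)
    then show ?thesis using that fn[of u] by (simp add: d w)
  qed
  obtain S where S: "\<And>y. E y S \<longleftrightarrow> (\<exists>n. E n d \<and> it n y)"
    using replacement[OF it_dfn] d by metis
  show thesis
  proof
    show "E a S" using S \<open>E z d\<close> it_z by blast
    show "\<exists>y. E y S \<and> G x y" if "E x S" for x
      using that S d_succ it_succ fn[of x] by metis
  qed
qed

lemma transitive_superset:
  obtains T where "E a T" "transitive E T"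
proof -
  have 1: "dfn E (\<lambda>e. \<forall>x. E x (e (Suc 0)) \<longleftrightarrow> (\<exists>y. E x y \<and> E y (e 0)))"
    by (intro dfn_intros)
  have 2: "\<exists>!u. \<forall>x. E x u \<longleftrightarrow> (\<exists>y. E x y \<and> E y v)" for v
  proof -
    obtain u where "\<forall>x. E x u \<longleftrightarrow> (\<exists>y. E x y \<and> E y v)" using union_ex by blast
    then show ?thesis by (intro ex1I[of _ u]) (auto intro: set_eqI)
  qed
  \<comment> \<open>The iteration of unions starts at the singleton of \<open>a\<close>, so that the
    union of \<open>S\<close> has \<open>a\<close> itself as a member.\<close>
  obtain S where S: "E (upair E a a) S"
    "\<And>x. E x S \<Longrightarrow> \<exists>u. E u S \<and> (\<forall>z. E z u \<longleftrightarrow> (\<exists>y. E z y \<and> E y x))"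
    using closure_under_functional[OF 1 2] by metis
  obtain T where T: "\<And>x. E x T \<longleftrightarrow> (\<exists>y. E x y \<and> E y S)" using union_ex by metis
  show thesis
  proof
    show "E a T" using T S(1) upair_iff[OF ZF] by metis
    show "transitive E T" unfolding transitive_def using T S(2) by metis
  qed
qed

subsection \<open>Levels of the cumulative hierarchy\<close>

text \<open>For a class \<open>H\<close> this is the union of the power sets of its members; a
  predicate argument allows restrictions of \<open>H\<close> to be written in place.\<close>

definition pot :: "('m \<Rightarrow> bool) \<Rightarrow> 'm \<Rightarrow> bool" where
  "pot H x \<longleftrightarrow> (\<exists>c. H c \<and> (\<forall>z. E z x \<longrightarrow> E z c))"

text \<open>
  Levels are introduced without ordinals, following Scott, Potter and Button: a history is an
  initial segment of the sequence of levels.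
\<close>

definition history :: "'m \<Rightarrow> bool" where
  "history h \<longleftrightarrow> (\<forall>c. E c h \<longrightarrow> (\<forall>x. E x c \<longleftrightarrow> pot (\<lambda>d. E d c \<and> E d h) x))"

definition level :: "'m \<Rightarrow> bool" where
  "level s \<longleftrightarrow> (\<exists>h. history h \<and> (\<forall>x. E x s \<longleftrightarrow> pot (\<lambda>c. E c h) x))"

lemma pot_ex: "\<exists>s. \<forall>x. E x s \<longleftrightarrow> pot (\<lambda>c. E c h) x"
proof -
  obtain u where u: "\<And>x. E x u \<longleftrightarrow> (\<exists>y. E x y \<and> E y h)" using union_ex by metis
  obtain p where p: "\<And>x. E x p \<longleftrightarrow> (\<forall>y. E y x \<longrightarrow> E y u)" using power_ex by metis
  have "dfn E (\<lambda>e. pot (\<lambda>c. E c h) (e 0))" unfolding pot_def by (intro dfn_intros)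
  then obtain s where "\<And>x. E x s \<longleftrightarrow> E x p \<and> pot (\<lambda>c. E c h) x"
    using separation[of "pot (\<lambda>c. E c h)"] by metis
  then show ?thesis using p u unfolding pot_def by metis
qed

lemma level_dfn: "dfn E (\<lambda>e. level (e 0))"
  unfolding level_def history_def pot_def by (intro dfn_intros)

lemmas level_dfn' [dfn_intros] = dfn_app1[OF level_dfn]

lemma level_subset: "level s \<Longrightarrow> E c s \<Longrightarrow> (\<And>z. E z x \<Longrightarrow> E z c) \<Longrightarrow> E x s"
  unfolding level_def pot_def by metis

text \<open>The set \<open>c\<close> is included in a member \<open>d\<close> of the history, so
  \<open>x\<close> lies in \<open>d\<close> and is itself included in a member of the
  history.\<close>

lemma level_trans: "level s \<Longrightarrow> E c s \<Longrightarrow> E x c \<Longrightarrow> E x s"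
  unfolding level_def history_def pot_def by metis

text \<open>In a minimal counterexample \<open>d\<close>, the set \<open>b\<close> is included in
  some \<open>k\<close> that lies in both \<open>d\<close> and \<open>h\<close>. By minimality
  \<open>k\<close> is transitive, so \<open>x\<close> is included in \<open>k\<close> and belongs to
  \<open>d\<close>.\<close>

lemma history_trans:
  assumes h: "history h" and "E c h" "E b c" "E x b"
  shows "E x c"
proof (rule ccontr)
  assume bad: "\<not> E x c"
  have "dfn E (\<lambda>e. \<exists>b x. E b (e 0) \<and> E x b \<and> \<not> E x (e 0))" by (intro dfn_intros)
  then obtain s where s: "\<And>c. E c s \<longleftrightarrow> E c h \<and> (\<exists>b x. E b c \<and> E x b \<and> \<not> E x c)"
    using separation[of "\<lambda>c. \<exists>b x. E b c \<and> E x b \<and> \<not> E x c" h] by blast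
  with assms bad have "E c s" by blast
  then obtain d where d: "E d s" "\<And>z. E z d \<Longrightarrow> \<not> E z s" by (rule foundation) blast
  then obtain b x where b: "E d h" "E b d" "E x b" "\<not> E x d" using s by blast
  then obtain k where k: "E k d" "E k h" "\<And>z. E z b \<Longrightarrow> E z k"
    using h unfolding history_def pot_def by metis
  then have "\<not> E k s" "E x k" using d b by auto
  then have "E z k" if "E z x" for z using s that k by blast
  then have "E x d" using h b k unfolding history_def pot_def by metis
  with b show False by blast
qed

text \<open>The members of \<open>h\<close> that lie in \<open>c\<close> form a history with
  \<open>c\<close> as its next level; transitivity keeps their own restrictions unchanged.\<close>

lemma history_level:
  assumes h: "history h" and c: "E c h"
  shows "level c"
proof -
  obtain k where k: "\<And>d. E d k \<longleftrightarrow> E d h \<and> E d c"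
    using separation[OF dfn_mem[OF tdef_var tdef_par[of E c]], of h] by blast
  have eq: "(\<lambda>e. E e d \<and> E e k) = (\<lambda>e. E e d \<and> E e h)" if "E d k" for d
    using history_trans[OF h c] that unfolding k fun_eq_iff by blast
  have "history k" unfolding history_def
  proof (intro allI impI)
    fix d x assume d: "E d k"
    then have "E d h" using k by blast
    then show "E x d \<longleftrightarrow> pot (\<lambda>e. E e d \<and> E e k) x"
      unfolding eq[OF d] using h unfolding history_def by blast
  qed
  moreover have "\<forall>x. E x c \<longleftrightarrow> pot (\<lambda>d. E d k) x"
    using h c unfolding history_def pot_def k by blast
  ultimately show ?thesis unfolding level_def by blast
qed

text \<open>This frees levels from their histories: a level is determined by the levels in
  it.\<close>

lemma level_acc:
  assumes "level s"
  shows "E x s \<longleftrightarrow> pot (\<lambda>r. E r s \<and> level r) x"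
proof -
  obtain h where h: "history h" "\<And>x. E x s \<longleftrightarrow> pot (\<lambda>c. E c h) x"
    using assms unfolding level_def by blast
  show ?thesis
  proof
    assume "E x s"
    then show "pot (\<lambda>r. E r s \<and> level r) x"
      unfolding h(2) using history_level[OF h(1)] unfolding pot_def by blast
  next
    assume "pot (\<lambda>r. E r s \<and> level r) x"
    then show "E x s" using level_subset[OF assms] unfolding pot_def by blast
  qed
qed

text \<open>Foundation is applied to the candidates in \<open>s\<close>; transitivity of
  \<open>s\<close> brings every candidate below the chosen one into that set. If there are none,
  \<open>s\<close> is least.\<close>

lemma least_level:
  assumes P: "dfn E (\<lambda>e. P (e 0))" and s: "level s" "P s"
  obtains t where "level t" "P t" "\<And>r. level r \<Longrightarrow> P r \<Longrightarrow> \<not> E r t"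
proof -
  note [dfn_intros] = dfn_app1[OF P]
  have "dfn E (\<lambda>e. level (e 0) \<and> P (e 0))" by (intro dfn_intros)
  then obtain b where b: "\<And>r. E r b \<longleftrightarrow> E r s \<and> level r \<and> P r"
    using separation[of "\<lambda>r. level r \<and> P r"] by metis
  show thesis
  proof (cases "\<exists>r. E r b")
    case True
    then obtain t where t: "E t b" "\<And>z. E z t \<Longrightarrow> \<not> E z b" using foundation by metis
    then show thesis using that[of t] b level_trans[OF s(1)] by blast
  next
    case False
    then show thesis using that[of s] s b by blast
  qed
qed

text \<open>Take a minimal \<open>s\<close> incomparable with some level and then a minimal
  \<open>t\<close> incomparable with \<open>s\<close>. They have the same levels as members, so they
  are equal by \<open>level_acc\<close>.\<close>

lemma level_linear:
  assumes "level s" "level t"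
  shows "E s t \<or> s = t \<or> E t s"
proof (rule ccontr)
  assume bad: "\<not> ?thesis"
  let ?I = "\<lambda>s t. \<not> (E s t \<or> s = t \<or> E t s)"
  have 1: "dfn E (\<lambda>e. \<exists>t. level t \<and> ?I (e 0) t)" by (intro dfn_intros)
  have "\<exists>t. level t \<and> ?I s t" using assms(2) bad by blast
  with least_level[of "\<lambda>s. \<exists>t. level t \<and> ?I s t", OF 1 assms(1)] obtain s where s: "level s" "\<exists>t. level t \<and> ?I s t"
    "\<And>r. level r \<Longrightarrow> \<exists>t. level t \<and> ?I r t \<Longrightarrow> \<not> E r s"
    by blast
  from s(2) obtain t where t: "level t" "?I s t" by blast
  have 2: "dfn E (\<lambda>e. ?I s (e 0))" by (intro dfn_intros)
  obtain t where t: "level t" "?I s t" "\<And>r. level r \<Longrightarrow> ?I s r \<Longrightarrow> \<not> E r t"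
    using least_level[of "\<lambda>t. ?I s t", OF 2 t] by blast
  have "E x s \<longleftrightarrow> E x t" for x
  proof
    assume "E x s"
    then obtain r where r: "E r s" "level r" "\<And>z. E z x \<Longrightarrow> E z r"
      using level_acc[OF s(1)] unfolding pot_def by metis
    then have "E r t" using s(3)[of r] t(1,2) level_trans[OF s(1)] by blast
    then show "E x t" using level_subset[OF t(1)] r by blast
  next
    assume "E x t"
    then obtain r where r: "E r t" "level r" "\<And>z. E z x \<Longrightarrow> E z r"
      using level_acc[OF t(1)] unfolding pot_def by metis
    then have "E r s" using t(3)[of r] t(2) s(1) level_trans[OF t(1)] by blast
    then show "E x s" using level_subset[OF s(1)] r by blast
  qed
  then show False using t(2) set_eqI by blast
qed

text \<open>Uniqueness, from linearity, makes the least level a functional to which replacement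
  applies.\<close>

lemma least_level_ex1:
  assumes "dfn E (\<lambda>e. P (e 0))" "level s" "P s"
  shows "\<exists>!t. level t \<and> P t \<and> (\<forall>r. level r \<longrightarrow> P r \<longrightarrow> \<not> E r t)"
proof -
  obtain t where "level t" "P t" "\<And>r. level r \<Longrightarrow> P r \<Longrightarrow> \<not> E r t"
    using least_level[OF assms] by metis
  then show ?thesis by (intro ex1I[of _ t]) (use level_linear in blast)+
qed

text \<open>The levels in \<open>H\<close> or in a member of \<open>H\<close> are closed downwards,
  hence form a history, whose next level lies above all of \<open>H\<close>.\<close>

lemma level_sup:
  assumes H: "\<And>r. E r H \<Longrightarrow> level r"
  obtains s where "level s" "\<And>r. E r H \<Longrightarrow> E r s"
proof -
  obtain u where u: "\<And>x. E x u \<longleftrightarrow> (\<exists>y. E x y \<and> E y H)" using union_ex by metis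
  obtain k where k: "\<And>x. E x k \<longleftrightarrow> E x u \<or> E x H"
    using union_ex[of "upair E u H"] by (auto simp: upair_iff[OF ZF])
  obtain h where h: "\<And>r. E r h \<longleftrightarrow> E r k \<and> level r"
    using separation[of level k, OF level_dfn] by metis
  have "history h" unfolding history_def
  proof (intro allI impI)
    fix c x assume c: "E c h"
    then have "level c" using h by blast
    have "E d c \<and> E d h \<longleftrightarrow> E d c \<and> level d" for d
    proof -
      have "E d k" if d: "E d c"
      proof -
        consider "E c H" | y where "E y H" "E c y" using c h k u by blast
        then obtain y where "E y H" "E d y"
          using d level_trans[OF H] by cases blast+
        then show ?thesis using k u by blast
      qed
      then show ?thesis using h by blast
    qed
    then have eq: "(\<lambda>d. E d c \<and> E d h) = (\<lambda>d. E d c \<and> level d)" by (rule ext)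
    show "E x c \<longleftrightarrow> pot (\<lambda>d. E d c \<and> E d h) x"
      unfolding eq by (rule level_acc) fact
  qed
  moreover obtain s where s: "\<forall>x. E x s \<longleftrightarrow> pot (\<lambda>c. E c h) x" using pot_ex by blast
  ultimately have "level s" unfolding level_def by blast
  moreover have "E r s" if "E r H" for r
  proof -
    have "E r h" using that h k H by simp
    then have "pot (\<lambda>c. E c h) r" unfolding pot_def by blast
    then show ?thesis using s by simp
  qed
  ultimately show thesis using that by blast
qed

text \<open>A minimal set outside all levels has all its members in levels. Their least levels are
  bounded by some level \<open>s\<close>, and the set, included in \<open>s\<close>, belongs to
  every level above \<open>s\<close>.\<close>

lemma mem_level: "\<exists>s. level s \<and> E a s"
proof (rule ccontr)
  assume a: "\<not> ?thesis"
  obtain T where T: "E a T" "transitive E T" by (rule transitive_superset)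
  have "dfn E (\<lambda>e. \<not> (\<exists>s. level s \<and> E (e 0) s))" by (intro dfn_intros)
  then obtain b where b: "\<And>x. E x b \<longleftrightarrow> E x T \<and> \<not> (\<exists>s. level s \<and> E x s)"
    using separation[of "\<lambda>x. \<not> (\<exists>s. level s \<and> E x s)"] by metis
  then have "E a b" using a T by blast
  then obtain x where x: "E x b" "\<And>y. E y x \<Longrightarrow> \<not> E y b" by (rule foundation) blast
  let ?L = "\<lambda>y t. level t \<and> E y t \<and> (\<forall>r. level r \<longrightarrow> E y r \<longrightarrow> \<not> E r t)"
  have L: "dfn E (\<lambda>e. ?L (e 0) (e (Suc 0)))" by (intro dfn_intros)
  have ex1: "\<exists>!t. ?L y t" if y: "E y x" for y
  proof -
    obtain s where "level s" "E y s"
      using b x y T(2) unfolding transitive_def by metis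
    then show ?thesis by (intro least_level_ex1) (intro dfn_intros)
  qed
  obtain H where H: "\<And>t. E t H \<longleftrightarrow> (\<exists>y. E y x \<and> ?L y t)"
    using replacement[of ?L x, OF L ex1] by blast
  obtain s where s: "level s" "\<And>r. E r H \<Longrightarrow> E r s" using level_sup[of H] H by metis
  have xs: "E y s" if y: "E y x" for y
  proof -
    obtain t where "level t" "E y t" "E t H"
      using H ex1[OF y] y by blast
    then show ?thesis using s level_trans by blast
  qed
  obtain s' where "level s'" "E s s'"
    using level_sup[of "upair E s s"] s(1) upair_iff[OF ZF] by metis
  then have "E x s'" using level_subset xs by blast
  then show False using b x(1) \<open>level s'\<close> by blast
qed

section \<open>Minimal elements of definable classes\<close>

text \<open>
  The relation need not be set-like: Scott's trick picks a set of predecessors for each element,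
  and \<open>\<omega>\<close> iterations turn a class without minimal element into such a set.
\<close>

lemma wf_class_minimal:
  assumes R: "dfn E (\<lambda>e. R (e 0) (e (Suc 0)))" and wf: "wf_in_model E R"
    and C: "dfn E (\<lambda>e. C (e 0))" and a: "C a"
  obtains y where "C y" "\<And>x. R x y \<Longrightarrow> \<not> C x"
proof (rule ccontr)
  assume contra: "\<not> thesis"
  have noMin: "\<exists>x. R x y \<and> C x" if "C y" for y
    using that contra \<open>\<And>y. C y \<Longrightarrow> (\<And>x. R x y \<Longrightarrow> \<not> C x) \<Longrightarrow> thesis\<close> by blast
  note [dfn_intros] = dfn_app1[OF C] dfn_app2[OF R]
  \<comment> \<open>\<open>?L y\<close> singles out the least level containing some predecessor of
    \<open>y\<close> in \<open>C\<close>; \<open>?G\<close> sends a set to the union of these levels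
    for its members in \<open>C\<close>.\<close>
  let ?M = "\<lambda>y t. \<exists>x. E x t \<and> R x y \<and> C x"
  let ?L = "\<lambda>y t. level t \<and> ?M y t \<and> (\<forall>r. level r \<longrightarrow> ?M y r \<longrightarrow> \<not> E r t)"
  let ?G = "\<lambda>s u. \<forall>x. E x u \<longleftrightarrow> (\<exists>y t. E y s \<and> C y \<and> ?L y t \<and> E x t)"
  have L: "\<exists>!t. ?L y t" if y: "C y" for y
  proof -
    obtain x where "R x y" "C x" using noMin y by blast
    moreover obtain s where "level s" "E x s" using mem_level by blast
    ultimately show ?thesis by (intro least_level_ex1) ((intro dfn_intros)?, blast+)
  qed
  have G: "\<exists>!u. ?G s u" for s
  proof -
    \<comment> \<open>Restriction to members in \<open>C\<close> is what makes the least level exist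
      and replacement applicable.\<close>
    obtain s' where s': "\<And>y. E y s' \<longleftrightarrow> E y s \<and> C y" using separation[OF C] by metis
    have "dfn E (\<lambda>e. ?L (e 0) (e (Suc 0)))" by (intro dfn_intros)
    moreover have "\<exists>!t. ?L y t" if "E y s'" for y by (rule L) (use that s' in blast)
    ultimately obtain H where H: "\<And>t. E t H \<longleftrightarrow> (\<exists>y. E y s' \<and> ?L y t)"
      using replacement[of ?L s'] by blast
    obtain u where "\<And>x. E x u \<longleftrightarrow> (\<exists>t. E x t \<and> E t H)" using union_ex by metis
    then have "?G s u" unfolding H s' by blast
    then show ?thesis by (intro ex1I[of _ u]) (auto intro!: set_eqI)
  qed
  have "dfn E (\<lambda>e. ?G (e 0) (e (Suc 0)))" by (intro dfn_intros)
  then obtain S where S: "E (upair E a a) S" "\<And>s. E s S \<Longrightarrow> \<exists>u. E u S \<and> ?G s u"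
    by (rule closure_under_functional[of ?G "upair E a a", OF _ G]) (rule that)
  obtain T where T: "\<And>x. E x T \<longleftrightarrow> (\<exists>s. E x s \<and> E s S)" using union_ex by metis
  obtain b where b: "\<And>x. E x b \<longleftrightarrow> E x T \<and> C x" using separation[OF C] by metis
  have "E a b" using b T S(1) a upair_iff[OF ZF] by metis
  moreover have "\<exists>x. E x b \<and> R x y" if y: "E y b" for y
  proof -
    obtain s where s: "E y s" "E s S" "C y" using y b T by metis
    obtain u where u: "E u S" "?G s u" using S(2)[OF s(2)] by blast
    obtain t where "?L y t" using L[OF s(3)] by blast
    moreover from this obtain x where "E x t" "R x y" "C x" by blast
    ultimately have "E x u" using u(2) s by blast
    then show ?thesis using b T u(1) \<open>R x y\<close> \<open>C x\<close> by metis
  qed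
  ultimately show False using wf unfolding wf_in_model_def by blast
qed

end


section \<open>Definability of falsity values\<close>

lemma foldr_case_nat:
  "foldr case_nat xs e i = (if i < length xs then xs ! i else e (i - length xs))"
  by (induction xs arbitrary: i) (auto split: nat.split)

lemma dfn_foldr:
  assumes "\<And>u. u \<in> set us \<Longrightarrow> tdef E u" "dfn E Q"
  shows "dfn E (\<lambda>e. Q (foldr case_nat (map (\<lambda>u. u e) us) e))"
  using assms
proof (induction us arbitrary: Q)
  case (Cons u us)
  let ?n = "length us"
  have env: "case_nat (e 0) (\<lambda>i. e (Suc i)) = e" for e :: "nat \<Rightarrow> 'a"
    by (auto split: nat.split)
  \<comment> \<open>After the values of \<open>us\<close> have been put in front, \<open>u\<close>
    must still see the original environment, found \<open>?n\<close> places further.\<close>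
  have "dfn E (\<lambda>e. Q (case_nat (u (\<lambda>i. e (i + ?n))) e))"
    by (rule dfn_term[OF tdef_shift, of E u "\<lambda>y e. Q (case_nat y e)" "\<lambda>i. i + ?n"])
      (use Cons.prems in \<open>simp_all add: env\<close>)
  from Cons.IH[OF _ this] Cons.prems(1) show ?case by (simp add: foldr_case_nat)
qed simp

lemma tdef_functional:
  assumes g: "definable_functional E (length us) g" and us: "\<And>u. u \<in> set us \<Longrightarrow> tdef E u"
  shows "tdef E (\<lambda>e. g (map (\<lambda>u. u e) us))"
proof -
  let ?n = "length us"
  obtain p e0 where p: "\<And>xs y. length xs = ?n \<Longrightarrow>
      y = g xs \<longleftrightarrow> sat E (foldr case_nat (y # xs) e0) p"
    using g unfolding definable_functional_def by blast
  \<comment> \<open>The environment will be the argument values followed by \<open>e\<close>, so the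
    value \<open>e 0\<close> sits at index \<open>?n\<close>; variables of \<open>p\<close> beyond
    the arguments are filled from \<open>e0\<close>.\<close>
  define v where "v i = (case i of 0 \<Rightarrow> (\<lambda>e. e ?n)
    | Suc i \<Rightarrow> if i < ?n then (\<lambda>e. e i) else (\<lambda>e. e0 (i - ?n)))" for i
  have Q: "dfn E (\<lambda>e. sat E (\<lambda>i. v i e) p)"
    by (rule dfnI[of v]) (simp_all add: v_def split: nat.split)
  let ?xs = "\<lambda>e. map (\<lambda>u. u (\<lambda>i. e (Suc i))) us"
  have "dfn E (\<lambda>e. sat E (\<lambda>i. v i (foldr case_nat
      (map (\<lambda>u. u e) (map (\<lambda>u e. u (\<lambda>i. e (Suc i))) us)) e)) p)"
    by (rule dfn_foldr[OF _ Q]) (use us tdef_shift in auto)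
  moreover have "v i (foldr case_nat (?xs e) e) = foldr case_nat (e 0 # ?xs e) e0 i" for i e
    by (cases i) (simp_all add: v_def foldr_case_nat)
  ultimately have "dfn E (\<lambda>e. sat E (foldr case_nat (e 0 # ?xs e) e0) p)"
    by (simp add: comp_def)
  then show ?thesis unfolding tdef_def by (subst p) simp_all
qed

lemma tdef_teval: "tm_ok E n t \<Longrightarrow> tdef E (\<lambda>e. teval e t)"
proof (induction t)
  case (Fn g ts)
  then have "tdef E (\<lambda>e. g (map (\<lambda>u. u e) (map (\<lambda>t e. teval e t) ts)))"
    by (intro tdef_functional) auto
  then show ?case by (simp add: comp_def)
qed (simp_all add: tdef_var tdef_par)

lemmas tdef_teval_shift = tdef_shift[OF tdef_teval]

lemma teval_cong: "tm_ok E n t \<Longrightarrow> (\<And>i. i < n \<Longrightarrow> e i = e' i) \<Longrightarrow> teval e t = teval e' t"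
proof (induction t)
  case (Fn g ts)
  then have "map (teval e) ts = map (teval e') ts" by auto
  then show ?case by (simp only: teval.simps)
qed auto

lemma falsity_cong:
  "zfe_formula E n F \<Longrightarrow> (\<And>i. i < n \<Longrightarrow> e i = e' i) \<Longrightarrow> falsity E A e F = falsity E A e' F"
proof (induction F arbitrary: n e e')
  case (Imp F G)
  then have "falsity E A e F = falsity E A e' F" "falsity E A e G = falsity E A e' G"
    using Imp.IH(1)[of n e e'] Imp.IH(2)[of n e e'] by simp_all
  then show ?case by simp
next
  case (Univ F)
  have "falsity E A (case_nat a e) F = falsity E A (case_nat a e') F" for a
    by (rule Univ.IH[of "Suc n"]) (use Univ.prems in \<open>auto split: nat.split\<close>)
  then show ?case by simp
next
  case (NEps t u)
  then show ?case using teval_cong[of E n t e e'] teval_cong[of E n u e e'] by simp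
next
  case (NIn t u)
  then show ?case using teval_cong[of E n t e e'] teval_cong[of E n u e e'] by simp
next
  case (Incl t u)
  then show ?case using teval_cong[of E n t e e'] teval_cong[of E n u e e'] by simp
qed auto

section \<open>Realizability algebras and their falsity values\<close>

lemma fapp_graph:
  assumes "is_fun E f D R" "x \<in> D"
  shows "E (pair E x y) f \<longleftrightarrow> y = fapp E f x"
proof -
  from assms have "\<exists>!y. E (pair E x y) f" by (simp add: is_fun_def)
  moreover from theI'[OF this] have "E (pair E x (fapp E f x)) f" unfolding fapp_def .
  ultimately show ?thesis by blast
qed

locale realg_model = zf_model E for E :: "'m \<Rightarrow> 'm \<Rightarrow> bool" +
  fixes A :: "'m realg"
  assumes alg: "realizability_algebra E A"
begin

abbreviation "trm x \<equiv> E x (Terms A)"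
abbreviation "stk x \<equiv> E x (Stacks A)"

lemma app_fun: "is_fun E (App A) (cart E (Terms A) (Terms A)) (ext E (Terms A))"
  and push_fun: "is_fun E (Push A) (cart E (Terms A) (Stacks A)) (ext E (Stacks A))"
  and star_fun: "is_fun E (Star A) (cart E (Terms A) (Stacks A)) (ext E (Procs A))"
  using alg by (simp_all add: realizability_algebra_def)

lemma app_closed: "trm x \<Longrightarrow> trm y \<Longrightarrow> trm (app E A x y)"
  unfolding app_def by (rule fapp_in[OF ZF app_fun]) (auto simp: cart_def ext_def)

lemma push_graph:
  assumes "trm x" "stk s"
  shows "E (pair E (pair E x s) y) (Push A) \<longleftrightarrow> y = push E A x s"
  unfolding push_def by (rule fapp_graph[OF push_fun]) (use assms in \<open>auto simp: cart_def ext_def\<close>)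

lemma star_graph:
  assumes "trm x" "stk s"
  shows "E (pair E (pair E x s) y) (Star A) \<longleftrightarrow> y = star E A x s"
  unfolding star_def by (rule fapp_graph[OF star_fun]) (use assms in \<open>auto simp: cart_def ext_def\<close>)

lemma push_closed: "trm x \<Longrightarrow> stk s \<Longrightarrow> stk (push E A x s)"
  unfolding push_def by (rule fapp_in[OF ZF push_fun]) (auto simp: cart_def ext_def)

lemma star_closed: "trm x \<Longrightarrow> stk s \<Longrightarrow> E (star E A x s) (Procs A)"
  unfolding star_def by (rule fapp_in[OF ZF star_fun]) (auto simp: cart_def ext_def)

text \<open>
  \<open>realizes_value\<close> mentions \<open>star\<close>, hence a description operator that is unspecified off the
  stacks; the following guarded version is definable, and agrees with it on sets of stacks.
\<close>

definition rz :: "'m \<Rightarrow> ('m \<Rightarrow> bool) \<Rightarrow> bool" where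
  "rz x V \<longleftrightarrow> trm x \<and> (\<forall>s. V s \<longrightarrow> (\<exists>q. E (pair E (pair E x s) q) (Star A) \<and> E q (Pole A)))"

lemma realizes_value_rz:
  assumes "\<And>s. s \<in> V \<Longrightarrow> stk s"
  shows "realizes_value E A x V \<longleftrightarrow> rz x (\<lambda>s. s \<in> V)"
  unfolding realizes_value_def rz_def using star_graph assms by metis

text \<open>With \<open>push\<close> and \<open>star\<close> replaced by their graphs the condition
  becomes definable. That the tables hold only stacks, a consequence of closure under
  \<open>push\<close>, is stated explicitly so that \<open>rz\<close> may stand for
  \<open>realizes_value\<close>.\<close>

lemma atomic_approx_guarded:
  "atomic_approx E A T i n \<longleftrightarrow> transitive E T \<and> (\<forall>a b. E a T \<and> E b T \<longrightarrow>
     (\<forall>q. E (pair E (pair E a b) q) i \<longrightarrow> stk q) \<and> (\<forall>q. E (pair E (pair E a b) q) n \<longrightarrow> stk q) \<and>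
     (\<forall>q. E (pair E (pair E a b) q) i \<longleftrightarrow> (\<exists>c x s. stk s \<and> E (pair E c s) a \<and>
        rz x (\<lambda>q. E (pair E (pair E c b) q) n) \<and> E (pair E (pair E x s) q) (Push A))) \<and>
     (\<forall>q. E (pair E (pair E a b) q) n \<longleftrightarrow> (\<exists>c x x' s. stk s \<and> E (pair E c s) b \<and>
        rz x (\<lambda>q. E (pair E (pair E a c) q) i) \<and> rz x' (\<lambda>q. E (pair E (pair E c a) q) i) \<and>
        (\<exists>s'. E (pair E (pair E x' s) s') (Push A) \<and> E (pair E (pair E x s') q) (Push A)))))"
  (is "_ \<longleftrightarrow> transitive E T \<and> (\<forall>a b. E a T \<and> E b T \<longrightarrow> ?B i a b \<and> ?B n a b \<and> ?I a b \<and> ?N a b)")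
proof (cases "transitive E T")
  case T: True
  let ?SI = "\<lambda>a b. {push E A x s | c x s. stk s \<and> E (pair E c s) a \<and>
    realizes_value E A x (tab E n c b)}"
  let ?SN = "\<lambda>a b. {push E A x (push E A x' s) | c x x' s. stk s \<and> E (pair E c s) b \<and>
    realizes_value E A x (tab E i a c) \<and> realizes_value E A x' (tab E i c a)}"
  \<comment> \<open>Transitivity is applied along \<open>c\<close>, its singleton, the pair,
    \<open>a\<close> and \<open>T\<close>; thus the table bounds also cover the entries at
    \<open>c\<close>.\<close>
  have comp: "E c T" if "E a T" "E (pair E c s) a" for a c s
  proof -
    have "E (upair E c c) (pair E c s)" "E c (upair E c c)"
      by (simp_all add: pair_def upair_iff[OF ZF])
    with that T show ?thesis unfolding transitive_def by blast
  qed
  have stkI: "stk q" if "q \<in> ?SI a b" for q a b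
    using that push_closed unfolding realizes_value_def by auto
  have stkN: "stk q" if "q \<in> ?SN a b" for q a b
    using that push_closed unfolding realizes_value_def by auto
  have eqv: "(tab E i a b = ?SI a b \<longleftrightarrow> ?I a b) \<and> (tab E n a b = ?SN a b \<longleftrightarrow> ?N a b)"
    if B: "\<And>a b. E a T \<Longrightarrow> E b T \<Longrightarrow> ?B i a b \<and> ?B n a b" and ab: "E a T" "E b T" for a b
  proof -
    have r: "realizes_value E A x (tab E j a b) \<longleftrightarrow> rz x (\<lambda>q. E (pair E (pair E a b) q) j)"
      if "E a T" "E b T" "j = i \<or> j = n" for x a b j
      using realizes_value_rz[of "tab E j a b" x] B that unfolding tab_def by auto
    have I: "q \<in> ?SI a b \<longleftrightarrow> (\<exists>c x s. stk s \<and> E (pair E c s) a \<and>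
        rz x (\<lambda>q. E (pair E (pair E c b) q) n) \<and> E (pair E (pair E x s) q) (Push A))" for q
    proof -
      have "stk s \<and> E (pair E c s) a \<and> realizes_value E A x (tab E n c b) \<and> q = push E A x s
        \<longleftrightarrow> stk s \<and> E (pair E c s) a \<and>
        rz x (\<lambda>q. E (pair E (pair E c b) q) n) \<and> E (pair E (pair E x s) q) (Push A)" for c x s
        using r[of c b n x] comp[of a c s] ab push_graph[of x s q] unfolding rz_def by blast
      then show ?thesis by blast
    qed
    have N: "q \<in> ?SN a b \<longleftrightarrow> (\<exists>c x x' s. stk s \<and> E (pair E c s) b \<and>
        rz x (\<lambda>q. E (pair E (pair E a c) q) i) \<and> rz x' (\<lambda>q. E (pair E (pair E c a) q) i) \<and>
        (\<exists>s'. E (pair E (pair E x' s) s') (Push A) \<and> E (pair E (pair E x s') q) (Push A)))" for q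
    proof -
      have "stk s \<and> E (pair E c s) b \<and> realizes_value E A x (tab E i a c) \<and>
          realizes_value E A x' (tab E i c a) \<and> q = push E A x (push E A x' s)
        \<longleftrightarrow> stk s \<and> E (pair E c s) b \<and>
        rz x (\<lambda>q. E (pair E (pair E a c) q) i) \<and> rz x' (\<lambda>q. E (pair E (pair E c a) q) i) \<and>
        (\<exists>s'. E (pair E (pair E x' s) s') (Push A) \<and> E (pair E (pair E x s') q) (Push A))"
        for c x x' s
      proof (cases "stk s \<and> E (pair E c s) b \<and> trm x \<and> trm x'")
        case True
        then show ?thesis
          using r[of a c i x] r[of c a i x'] comp[of b c s] ab push_graph[of x' s]
            push_graph[of x "push E A x' s" q] push_closed[of x' s] by auto
      next
        case False
        then show ?thesis unfolding rz_def realizes_value_def by blast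
      qed
      then show ?thesis by blast
    qed
    show ?thesis unfolding I[symmetric] N[symmetric] by (simp only: tab_def set_eq_iff mem_Collect_eq)
  qed
  show ?thesis
  proof
    assume ap: "atomic_approx E A T i n"
    then have t: "tab E i a b = ?SI a b" "tab E n a b = ?SN a b" if "E a T" "E b T" for a b
      using that unfolding atomic_approx_def by blast+
    have B: "?B i a b \<and> ?B n a b" if "E a T" "E b T" for a b
    proof -
      have "stk q" if "q \<in> tab E i a b" for q
        using that unfolding t(1)[OF \<open>E a T\<close> \<open>E b T\<close>] by (rule stkI)
      moreover have "stk q" if "q \<in> tab E n a b" for q
        using that unfolding t(2)[OF \<open>E a T\<close> \<open>E b T\<close>] by (rule stkN)
      ultimately show ?thesis by (simp add: tab_def)
    qed
    show "transitive E T \<and> (\<forall>a b. E a T \<and> E b T \<longrightarrow> ?B i a b \<and> ?B n a b \<and> ?I a b \<and> ?N a b)"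
    proof (rule conjI[OF T], intro allI impI, elim conjE)
      fix a b assume ab: "E a T" "E b T"
      note iff = eqv[OF B ab]
      have "?I a b \<and> ?N a b"
        by (rule conjI[OF iffD1[OF conjunct1[OF iff] t(1)[OF ab]]
              iffD1[OF conjunct2[OF iff] t(2)[OF ab]]])
      then show "?B i a b \<and> ?B n a b \<and> ?I a b \<and> ?N a b"
        by (rule conjI[OF conjunct1[OF B[OF ab]] conjI[OF conjunct2[OF B[OF ab]]]])
    qed
  next
    assume g: "transitive E T \<and> (\<forall>a b. E a T \<and> E b T \<longrightarrow> ?B i a b \<and> ?B n a b \<and> ?I a b \<and> ?N a b)"
    then have B: "?B i a b \<and> ?B n a b" if "E a T" "E b T" for a b using that by blast
    show "atomic_approx E A T i n"
      unfolding atomic_approx_def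
    proof (rule conjI[OF T], intro allI impI, elim conjE)
      fix a b assume ab: "E a T" "E b T"
      with g have "?I a b" "?N a b" by blast+
      note iff = eqv[OF B ab]
      show "tab E i a b = ?SI a b \<and> tab E n a b = ?SN a b"
        by (rule conjI[OF iffD2[OF conjunct1[OF iff] \<open>?I a b\<close>] iffD2[OF conjunct2[OF iff] \<open>?N a b\<close>]])
    qed
  qed
qed (simp add: atomic_approx_def)

lemma dfn_atomic_approx [dfn_intros]: "dfn E (\<lambda>e. atomic_approx E A (e i) (e j) (e k))"
  unfolding atomic_approx_guarded transitive_def rz_def by (intro dfn_intros)

text \<open>Being sets of stacks, falsity values allow \<open>realizes_value\<close> to be replaced
  by the definable \<open>rz\<close>.\<close>

lemma falsity_stk: "s \<in> falsity E A e F \<Longrightarrow> stk s"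
proof (induction F arbitrary: e s)
  case (NIn t u)
  then obtain T i n where "atomic_approx E A T i n" "E (teval e t) T" "E (teval e u) T"
    "s \<in> tab E n (teval e t) (teval e u)" by (auto simp: falsity_NIn_def)
  then show ?case unfolding atomic_approx_guarded tab_def by blast
next
  case (Incl t u)
  then obtain T i n where "atomic_approx E A T i n" "E (teval e t) T" "E (teval e u) T"
    "s \<in> tab E i (teval e t) (teval e u)" by (auto simp: falsity_Incl_def)
  then show ?case unfolding atomic_approx_guarded tab_def by blast
next
  case (Imp F G)
  then show ?case by (auto simp: realizes_value_def intro: push_closed)
qed (auto simp: ext_def split: if_splits)

text \<open>The induction runs outside the model and gives each \<open>F\<close> its own definition;
  the cases of \<open>NIn\<close> and \<open>Incl\<close> quantify over approximations, and
  implication uses \<open>rz\<close> and the graph of \<open>push\<close>.\<close>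

lemma dfn_falsity: "zfe_formula E n F \<Longrightarrow> dfn E (\<lambda>e. e 0 \<in> falsity E A (\<lambda>i. e (Suc i)) F)"
proof (induction F arbitrary: n)
  case Top
  show ?case by (simp add: dfn_const)
next
  case Bot
  show ?case by (simp add: ext_def, intro dfn_intros)
next
  case (NEps t u)
  then have "tm_ok E n t" "tm_ok E n u" by auto
  note [dfn_intros] = this[THEN tdef_teval_shift]
  show ?case by (simp, intro dfn_intros)
next
  case (NIn t u)
  then have "tm_ok E n t" "tm_ok E n u" by auto
  note [dfn_intros] = this[THEN tdef_teval_shift]
  show ?case by (simp add: falsity_NIn_def tab_def, intro dfn_intros)
next
  case (Incl t u)
  then have "tm_ok E n t" "tm_ok E n u" by auto
  note [dfn_intros] = this[THEN tdef_teval_shift]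
  show ?case by (simp add: falsity_Incl_def tab_def, intro dfn_intros)
next
  case (Imp F G)
  have shift: "dfn E (\<lambda>e. e j \<in> falsity E A (\<lambda>i. e (r i)) H)"
    if "dfn E (\<lambda>e. e 0 \<in> falsity E A (\<lambda>i. e (Suc i)) H)" for j r and H :: "'m form"
    using dfn_shift[OF that, of "case_nat j r"] by simp
  have "zfe_formula E n F" "zfe_formula E n G" using Imp.prems by auto
  note [dfn_intros] = shift[OF Imp.IH(1)[OF this(1)]] shift[OF Imp.IH(2)[OF this(2)]]
  have "q \<in> falsity E A e (Imp F G) \<longleftrightarrow> (\<exists>x s. rz x (\<lambda>s. s \<in> falsity E A e F) \<and>
      s \<in> falsity E A e G \<and> E (pair E (pair E x s) q) (Push A))" for q e
  proof -
    have "realizes_value E A x (falsity E A e F) \<and> s \<in> falsity E A e G \<and> q = push E A x s \<longleftrightarrow>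
      rz x (\<lambda>s. s \<in> falsity E A e F) \<and>
      s \<in> falsity E A e G \<and> E (pair E (pair E x s) q) (Push A)" for x s
      using realizes_value_rz[of "falsity E A e F" x, OF falsity_stk[of _ e F]] push_graph[of x s q]
        falsity_stk[of s e G] unfolding rz_def by blast
    then show ?thesis unfolding falsity.simps mem_Collect_eq by blast
  qed
  then show ?case unfolding rz_def by (simp only:) (intro dfn_intros)
next
  case (Univ F)
  then have "dfn E (\<lambda>e. e 0 \<in> falsity E A (\<lambda>i. e (Suc i)) F)" by simp
  \<comment> \<open>Below the quantifier its witness is coordinate 0 and the stack is coordinate
    1.\<close>
  from dfn_shift[OF this, of "case_nat 1 (case_nat 0 (\<lambda>i. Suc (Suc i)))"]
  have 1: "dfn E (\<lambda>e. e 1 \<in> falsity E A (\<lambda>i. e (case_nat 0 (\<lambda>i. Suc (Suc i)) i)) F)" by simp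
  have 2: "(\<lambda>i. e (case_nat 0 (\<lambda>i. Suc (Suc i)) i)) = case_nat (e 0) (\<lambda>i. e (Suc (Suc i)))"
    for e :: "nat \<Rightarrow> 'm"
    by (auto split: nat.split)
  have "dfn E (\<lambda>e. \<exists>a. e 0 \<in> falsity E A (case_nat a (\<lambda>i. e (Suc i))) F)"
    using 1 unfolding 2 by (intro dfn_ex) simp
  then show ?case by simp
qed simp

section \<open>The fixed point combinator\<close>

lemma anti_exec:
  assumes "exec E A (star E A x s) (star E A x' s')" "E (star E A x' s') (Pole A)"
    "trm x" "stk s" "trm x'" "stk s'"
  shows "E (star E A x s) (Pole A)"
proof -
  have "\<forall>x s x' s'. E x (Terms A) \<and> E s (Stacks A) \<and> E x' (Terms A) \<and> E s' (Stacks A) \<and>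
      exec E A (star E A x s) (star E A x' s') \<and> E (star E A x' s') (Pole A) \<longrightarrow>
      E (star E A x s) (Pole A)"
    using alg unfolding realizability_algebra_def by (elim conjE)
  then show ?thesis using assms by blast
qed

lemma exec_app:
  assumes "trm x" "trm y" "stk s"
  shows "exec E A (star E A (app E A x y) s) (star E A x (push E A y s))"
  using assms star_closed app_closed push_closed
  by (simp add: exec_def exec_closed_def Let_def ext_def)

lemma A_term_closed: "trm (A_term E A)"
proof -
  have "trm (cB A)" "trm (cC A)" "trm (cW A)"
    using alg by (simp_all add: realizability_algebra_def ext_def)
  then show ?thesis by (simp add: A_term_def app_closed)
qed

lemma Y_term_closed: "trm (Y_term E A)"
  by (simp add: Y_term_def app_closed A_term_closed)

text \<open>Two anti-execution steps: writing \<open>a\<close> for \<open>A_term E A\<close>, the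
  process \<open>(a)a \<star> x \<cdot> s\<close> reduces to
  \<open>a \<star> a \<cdot> x \<cdot> s\<close>, and this to
  \<open>x \<star> ((a)a)x \<cdot> s\<close>.\<close>

lemma Y_term_pole:
  assumes "trm x" "stk s" "E (star E A x (push E A (app E A (Y_term E A) x) s)) (Pole A)"
  shows "E (star E A (Y_term E A) (push E A x s)) (Pole A)"
proof -
  note closed = assms(1,2) A_term_closed Y_term_closed app_closed push_closed
  have "E (star E A (A_term E A) (push E A (A_term E A) (push E A x s))) (Pole A)" (is ?p)
    by (rule anti_exec[OF exec_A_term[OF ZF alg]])
      (use assms(3) closed in \<open>simp_all add: Y_term_def\<close>)
  show ?thesis unfolding Y_term_def
    by (rule anti_exec[OF exec_app]) (simp_all add: closed \<open>?p\<close>)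
qed

end

section \<open>Realization of well-founded induction\<close>

theorem theorem11:
  fixes E :: "'m \<Rightarrow> 'm \<Rightarrow> bool"
    and A :: "'m realg"
    and f :: "'m \<Rightarrow> 'm \<Rightarrow> 'm"
    and F :: "'m form"
  assumes "ZF E" and "V_eq_L E"
    and "realizability_algebra E A" and "coherent E A"
    and "definable_functional E 2 (binary f)"
    and "\<And>x y. f x y \<in> {emptyset E, one E}"
    and "wf_in_model E (\<lambda>x y. f x y = one E)"
    and "zfe_formula E 1 F"
    \<comment> \<open>Under the binder of \<open>x\<close> as well as under that of \<open>y\<close> alone, the nearest bound variable has
        index 0, so \<open>F[x]\<close> and \<open>F[y]\<close> are both represented by \<open>F\<close>.\<close>
  shows "realizes E A (Y_term E A)
           (Imp (Univ (Imp (Univ (Hook (Fn (binary f) [Var 0, Var 1]) (Par (one E)) F)) F))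
                (Univ F))"
proof -
  interpret realg_model E A
    using assms(1,3) by (simp add: realg_model_def zf_model_def realg_model_axioms_def)
  let ?R = "\<lambda>x y. f x y = one E" and ?Y = "Y_term E A"
  let ?H = "Univ (Imp (Univ (Hook (Fn (binary f) [Var 0, Var 1]) (Par (one E)) F)) F)"
  have "tdef E (\<lambda>e. binary f (map (\<lambda>u. u e) [\<lambda>e. e 0, \<lambda>e. e (Suc 0)]))"
    by (rule tdef_functional) (use assms(5) in \<open>auto simp: tdef_var numeral_2_eq_2\<close>)
  then have R: "dfn E (\<lambda>e. ?R (e 0) (e (Suc 0)))"
    by (intro dfn_eq tdef_par) (simp add: binary_def)
  show ?thesis unfolding realizes_def
  proof
    fix e :: "nat \<Rightarrow> 'm"
    let ?V = "\<lambda>y. falsity E A (case_nat y e) F"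
    \<comment> \<open>\<open>F\<close> has free variable 0 only, so the outer \<open>y\<close> is
      invisible to \<open>F[x]\<close>.\<close>
    have F2: "falsity E A (case_nat x (case_nat y e)) F = ?V x" for x y
      by (rule falsity_cong[OF assms(8)]) simp
    have pole: "E (star E A ?Y (push E A x s)) (Pole A)"
      if x: "realizes_value E A x (falsity E A e ?H)" and s: "s \<in> ?V y" for x s y
    proof (rule ccontr)
      assume bad: "\<not> ?thesis"
      have trm: "trm x" using x by (simp add: realizes_value_def)
      \<comment> \<open>Written with graphs instead of \<open>push\<close> and \<open>star\<close>,
        so that \<open>dfn_intros\<close> can show that \<open>C\<close> is definable.\<close>
      define C where "C y \<longleftrightarrow> (\<exists>s. s \<in> ?V y \<and> (\<exists>k q. E (pair E (pair E x s) k) (Push A) \<and>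
        E (pair E (pair E ?Y k) q) (Star A) \<and> \<not> E q (Pole A)))" for y
      have C: "C y \<longleftrightarrow> (\<exists>s. s \<in> ?V y \<and> \<not> E (star E A ?Y (push E A x s)) (Pole A))" for y
        unfolding C_def
        using push_graph[OF trm] star_graph[OF Y_term_closed] push_closed[OF trm] falsity_stk
        by metis
      \<comment> \<open>The tail of the environment is frozen to the constants \<open>e i\<close>,
        leaving the stack and the individual as the only coordinates.\<close>
      have "dfn E (\<lambda>e'. e' 0 \<in> falsity E A
          (\<lambda>i. (case i of 0 \<Rightarrow> \<lambda>e'. e' (Suc 0) | Suc i \<Rightarrow> \<lambda>e'. e i) e') F)"
        using dfn_subst[OF dfn_falsity[OF assms(8)], of "case_nat (\<lambda>e'. e' 0)
          (case_nat (\<lambda>e'. e' (Suc 0)) (\<lambda>i e'. e i))"]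
        by (simp split: nat.split)
      moreover have "(\<lambda>i. (case i of 0 \<Rightarrow> \<lambda>e'. e' (Suc 0) | Suc i \<Rightarrow> \<lambda>e'. e i) e')
          = case_nat (e' (Suc 0)) e" for e' :: "nat \<Rightarrow> 'm"
        by (auto split: nat.split)
      ultimately have V: "dfn E (\<lambda>e. e 0 \<in> ?V (e (Suc 0)))" by simp
      note [dfn_intros] = dfn_app2[OF V]
      have "dfn E (\<lambda>e. C (e 0))" unfolding C_def by (intro dfn_intros)
      moreover have "C y" using s bad C by blast
      ultimately obtain y where y: "C y" "\<And>z. ?R z y \<Longrightarrow> \<not> C z"
        using wf_class_minimal[of ?R C, OF R assms(7)] by blast
      then obtain s where s: "s \<in> ?V y" "\<not> E (star E A ?Y (push E A x s)) (Pole A)"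
        using C by blast
      \<comment> \<open>By minimality of \<open>y\<close>, no \<open>z\<close> with
        \<open>?R z y\<close> lies in \<open>C\<close>, which puts the reduct in the pole.\<close>
      have Yx: "E (star E A (app E A ?Y x) t) (Pole A)" if "t \<in> ?V z" "?R z y" for t z
      proof (rule anti_exec[OF exec_app])
        show "E (star E A ?Y (push E A x t)) (Pole A)" using that y(2) C by blast
      qed (use that trm falsity_stk in \<open>auto intro: Y_term_closed app_closed push_closed\<close>)
      \<comment> \<open>For all other \<open>z\<close> the hooked formula has an empty falsity
        value.\<close>
      then have "realizes_value E A (app E A ?Y x) (falsity E A (case_nat y e)
          (Univ (Hook (Fn (binary f) [Var 0, Var 1]) (Par (one E)) F)))"
        using app_closed[OF Y_term_closed trm]
        by (auto simp: F2 binary_def realizes_value_def split: if_splits)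
      then have "push E A (app E A ?Y x) s \<in> falsity E A (case_nat y e)
          (Imp (Univ (Hook (Fn (binary f) [Var 0, Var 1]) (Par (one E)) F)) F)"
        using s(1) unfolding falsity.simps(6) by blast
      then have "push E A (app E A ?Y x) s \<in> falsity E A e ?H"
        unfolding falsity.simps(7)[of E A e] by (rule UN_I[OF UNIV_I])
      then have "E (star E A x (push E A (app E A ?Y x) s)) (Pole A)"
        using x unfolding realizes_value_def by blast
      then show False using s falsity_stk trm Y_term_pole by blast
    qed
    show "realizes_value E A ?Y (falsity E A e (Imp ?H (Univ F)))"
      unfolding realizes_value_def using Y_term_closed pole by auto
  qed
qed

end
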